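(* $\overline{n}_+(2) = 8$. Moreover, up to isomorphism, the only vertex-transitive graph $G$ with $|V(G)| \leq 8$ and $r_+(G) = 2$ is the circulant graph $C_8^{\{1,2\}}$.
   Context: All graphs are finite, simple and undirected. For $P \subseteq [0,1]^n$ let $\mathrm{cone}(P) = \{ (\lambda, \lambda x) \in \mathbb{R}^{n+1} : \lambda \geq 0, x \in P\}$, where the coordinates of $\mathbb{R}^{n+1}$ are indexed by $0,1,\ldots,n$ (first coordinate $0$), and $e_i$ is the $i$-th unit vector. Let $\widehat{\mathrm{LS}}_+(P)$ be the set of real symmetric positive semidefinite $(n+1)\times(n+1)$ matrices $Y$ with $Ye_0 = \mathrm{diag}(Y)$ (the vector of diagonal entries of $Y$) and $Ye_i,\ Y(e_0-e_i) \in \mathrm{cone}(P)$ for all $i \in \{1,\ldots,n\}$. Define $\mathrm{LS}_+(P) = \{ x \in \mathbb{R}^n : \exists\, Y \in \widehat{\mathrm{LS}}_+(P),\ Ye_0 = (1,x)\}$, $\mathrm{LS}_+^0(P) = P$ and $\mathrm{LS}_+^{\ell}(P) = \mathrm{LS}_+(\mathrm{LS}_+^{\ell-1}(P))$ for $\ell \geq 1$. For a graph $G$, $\mathrm{FRAC}(G) = \{ x \in [0,1]^{V(G)} : x_i + x_j \leq 1\ \forall \{i,j\} \in E(G)\}$, $\mathrm{STAB}(G)$ is the convex hull of the $0,1$-vectors in $\mathrm{FRAC}(G)$, and $\mathrm{LS}_+^{\ell}(G)$ denotes $\mathrm{LS}_+^{\ell}(\mathrm{FRAC}(G))$. The $\mathrm{LS}_+$-rank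 $r_+(G)$ is the smallest integer $\ell \geq 0$ with $\mathrm{LS}_+^{\ell}(G) = \mathrm{STAB}(G)$. For a positive integer $\ell$, $\overline{n}_+(\ell)$ denotes the minimum number of vertices among vertex-transitive graphs with $\mathrm{LS}_+$-rank exactly $\ell$. For $S \subseteq \{1,\ldots,n\}$, the circulant graph $C_n^S$ has vertex set $\{1,\ldots,n\}$ and edge set consisting of all $\{i,j\}$ with $(j-i) \bmod n \in S$ or $(i-j) \bmod n \in S$. *)

theory Defs
  imports "HOL-Analysis.Analysis" "HOL-Library.Function_Algebras" "Graph_Theory.Graph_Theory"
begin

text \<open>
  The space R^V for a finite set V is represented by the functions that vanish outside V.
  The pointwise vector space structure on functions makes the library's convex hull applicable.
\<close>

instantiation "fun" :: (type, real_vector) real_vector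
begin

definition scaleR_fun :: "real \<Rightarrow> ('a \<Rightarrow> 'b) \<Rightarrow> 'a \<Rightarrow> 'b" where
  "scaleR_fun c f = (\<lambda>x. c *\<^sub>R f x)"

instance
  by standard (simp_all add: scaleR_fun_def fun_eq_iff scaleR_add_right scaleR_add_left)

end


text \<open>
  Homogenised vectors and matrices are indexed by \<open>hidx V\<close>: the index \<open>None\<close> is the extra
  coordinate 0, and \<open>Some i\<close> is the coordinate of \<open>i \<in> V\<close>.
\<close>

definition hidx :: "'a set \<Rightarrow> 'a option set" where
  "hidx V = insert None (Some ` V)"

definition hvec :: "real \<Rightarrow> ('a \<Rightarrow> real) \<Rightarrow> 'a option \<Rightarrow> real" where
  "hvec a x = (\<lambda>k. case k of None \<Rightarrow> a | Some i \<Rightarrow> x i)"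

definition hcone :: "('a \<Rightarrow> real) set \<Rightarrow> ('a option \<Rightarrow> real) set" where
  "hcone P = {hvec c (c *\<^sub>R x) | c x. c \<ge> 0 \<and> x \<in> P}"

definition unit_at :: "'i \<Rightarrow> 'i \<Rightarrow> real" where
  "unit_at i = (\<lambda>j. if j = i then 1 else 0)"

definition mat_on :: "'i set \<Rightarrow> ('i \<Rightarrow> 'i \<Rightarrow> real) \<Rightarrow> bool" where
  "mat_on I Y \<longleftrightarrow> (\<forall>i j. i \<notin> I \<or> j \<notin> I \<longrightarrow> Y i j = 0)"

definition mat_app :: "'i set \<Rightarrow> ('i \<Rightarrow> 'i \<Rightarrow> real) \<Rightarrow> ('i \<Rightarrow> real) \<Rightarrow> 'i \<Rightarrow> real" where
  "mat_app I Y v = (\<lambda>i. \<Sum>j\<in>I. Y i j * v j)"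

definition mat_diag :: "('i \<Rightarrow> 'i \<Rightarrow> real) \<Rightarrow> 'i \<Rightarrow> real" where
  "mat_diag Y = (\<lambda>i. Y i i)"

definition sym_psd_on :: "'i set \<Rightarrow> ('i \<Rightarrow> 'i \<Rightarrow> real) \<Rightarrow> bool" where
  "sym_psd_on I Y \<longleftrightarrow> (\<forall>i\<in>I. \<forall>j\<in>I. Y i j = Y j i) \<and>
     (\<forall>v. (\<Sum>i\<in>I. \<Sum>j\<in>I. v i * Y i j * v j) \<ge> 0)"

definition LS_plus_hat :: "'a set \<Rightarrow> ('a \<Rightarrow> real) set \<Rightarrow> ('a option \<Rightarrow> 'a option \<Rightarrow> real) set" where
  "LS_plus_hat V P = {Y. mat_on (hidx V) Y \<and> sym_psd_on (hidx V) Y \<and>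
     mat_app (hidx V) Y (unit_at None) = mat_diag Y \<and>
     (\<forall>i\<in>V. mat_app (hidx V) Y (unit_at (Some i)) \<in> hcone P \<and>
            mat_app (hidx V) Y (unit_at None - unit_at (Some i)) \<in> hcone P)}"

definition LS_plus :: "'a set \<Rightarrow> ('a \<Rightarrow> real) set \<Rightarrow> ('a \<Rightarrow> real) set" where
  "LS_plus V P = {x. \<exists>Y\<in>LS_plus_hat V P. mat_app (hidx V) Y (unit_at None) = hvec 1 x}"


text \<open>
  A finite simple undirected graph is a \<open>pair_graph\<close>: an edge {u, v} is represented by the two
  arcs (u, v) and (v, u).
\<close>

definition FRAC :: "'a pair_pre_digraph \<Rightarrow> ('a \<Rightarrow> real) set" where
  "FRAC G = {x. (\<forall>i\<in>pverts G. 0 \<le> x i \<and> x i \<le> 1) \<and> (\<forall>i. i \<notin> pverts G \<longrightarrow> x i = 0) \<and>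
     (\<forall>(i, j)\<in>parcs G. x i + x j \<le> 1)}"

definition STAB :: "'a pair_pre_digraph \<Rightarrow> ('a \<Rightarrow> real) set" where
  "STAB G = convex hull {x \<in> FRAC G. \<forall>i\<in>pverts G. x i \<in> {0, 1}}"

definition LS_plus_graph :: "nat \<Rightarrow> 'a pair_pre_digraph \<Rightarrow> ('a \<Rightarrow> real) set" where
  "LS_plus_graph l G = (LS_plus (pverts G) ^^ l) (FRAC G)"

definition LS_plus_rank :: "'a pair_pre_digraph \<Rightarrow> nat" where
  "LS_plus_rank G = (LEAST l. LS_plus_graph l G = STAB G)"

definition graph_iso :: "'a pair_pre_digraph \<Rightarrow> 'b pair_pre_digraph \<Rightarrow> bool" where
  "graph_iso G H \<longleftrightarrow> digraph_iso (with_proj G) (with_proj H)"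

definition vertex_transitive :: "'a pair_pre_digraph \<Rightarrow> bool" where
  "vertex_transitive G \<longleftrightarrow> (\<forall>u\<in>pverts G. \<forall>v\<in>pverts G.
     \<exists>h. pre_digraph.digraph_isomorphism (with_proj G) h \<and>
         app_iso h (with_proj G) = with_proj G \<and> iso_verts h u = v)"

text \<open>
  Every finite graph is isomorphic to one whose vertices are natural numbers, so it suffices
  to minimise over the latter.
\<close>

definition n_plus_bar :: "nat \<Rightarrow> nat" where
  "n_plus_bar l = (LEAST n. \<exists>G :: nat pair_pre_digraph.
     pair_graph G \<and> vertex_transitive G \<and> LS_plus_rank G = l \<and> card (pverts G) = n)"

definition circulant :: "nat \<Rightarrow> nat set \<Rightarrow> nat pair_pre_digraph" where
  "circulant n S = \<lparr>pverts = {1..n},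
     parcs = {(i, j). i \<in> {1..n} \<and> j \<in> {1..n} \<and>
       ((int j - int i) mod int n \<in> int ` S \<or> (int i - int j) mod int n \<in> int ` S)}\<rparr>"

lemma pair_graph_circulant:
  assumes "S \<subseteq> {1..n}"
  shows "pair_graph (circulant n S)"
proof
  show "finite (parcs (circulant n S))"
    by (rule finite_subset[of _ "{1..n} \<times> {1..n}"]) (auto simp: circulant_def)
  show "symmetric (with_proj (circulant n S))"
    by (auto simp: symmetric_def circulant_def intro: symI)
  show "fst e \<noteq> snd e" if "e \<in> parcs (circulant n S)" for e
    using that assms by (auto simp: circulant_def)
qed (auto simp: circulant_def)

end

theory Submission
  imports Defs
begin

text \<open>
  If an inequality \<open>a x \<le> b\<close> with \<open>a \<ge> 0\<close> holds on \<open>P\<close> whenever some \<open>x\<^sub>i\<close> with \<open>a\<^sub>i > 0\<close> equals 1, then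
  it is valid for \<open>LS\<^sub>+(P)\<close>: test positive semidefiniteness against \<open>(-b, a)\<close>. Hence the rank is at most
  1 if the non-neighbours of every vertex induce a bipartite graph, and at most 2 if they form a
  clique, since clique inequalities are valid for \<open>LS\<^sub>+(G)\<close>.

  In a vertex-transitive graph with at most 8 vertices and degree \<open>d\<close>, the non-neighbours can induce a
  non-bipartite graph only if \<open>2 \<le> d \<le> 4\<close>. For \<open>d \<le> 3\<close>, counting triangles shows that the graph is a
  disjoint union of two cliques. For \<open>d = 4\<close> the complement is a cubic triangle-free graph on 8
  vertices, hence the cube or the Wagner graph. A graph made of two cliques joined by a partial
  matching, such as the complement of the cube, is described by its clique inequalities, so it has
  rank at most 1. The complement of the Wagner graph is the squared 8-cycle; there the constant
  vector \<open>9/32\<close> lies in \<open>LS\<^sub>+(G)\<close> but violates the bound 2 on the size of a stable set.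
\<close>

section \<open>The operator on convex sets\<close>

text \<open>The local criterion cannot finish the case \<open>d = 4\<close>: in the complement of
  the cube, as in the squared 8-cycle, the non-neighbours of every vertex form a triangle, yet the
  first graph has rank at most 1 and the second has rank 2. So the complement has to be identified
  completely, and the two-clique graphs need a global argument with explicit multipliers. The range
  of \<open>d\<close>: for \<open>d <= 1\<close> the graph is a matching, and for
  \<open>d >= 5\<close> at most two non-neighbours remain. For \<open>d <= 3\<close> the tool is
  that 3 divides \<open>n t\<close>, where \<open>n\<close> is the order and \<open>t\<close> the
  number of triangles at a vertex. Origin of 9/32: for a constant vector \<open>c\<close> and lower
  block \<open>c C\<close>, the bordered matrix is positive semidefinite iff \<open>C - c J\<close>
  is. On constant vectors this says that \<open>8 c\<close> is at most the row sum of
  \<open>C\<close>, so the row sum 9/4 allows \<open>c = 9/32\<close>. In \<open>C\<close>, the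
  equal entries at 3 and 5 belong to adjacent vertices, so 1/2 is the largest value. An entry
  \<open>t\<close> at 4 gives row sum \<open>2 + t\<close>, so any positive \<open>t\<close> beats
  the bound 2, while frequency 1 has eigenvalue \<open>1 - t - sqrt 2 / 2\<close>; the choice 1/4 is
  a rational value that keeps it positive.\<close>

lemma sum_hidx: "finite V \<Longrightarrow> sum f (hidx V) = f None + (\<Sum>i\<in>V. f (Some i))"
  by (simp add: hidx_def sum.insert_if sum.reindex)

lemma finite_hidx: "finite V \<Longrightarrow> finite (hidx V)"
  by (simp add: hidx_def)

lemma hidx_simps [simp]: "None \<in> hidx V" "Some i \<in> hidx V \<longleftrightarrow> i \<in> V"
  by (auto simp: hidx_def)

lemma mat_app_unit:
  assumes "finite I" "k \<in> I"
  shows "mat_app I Y (unit_at k) = (\<lambda>i. Y i k)"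
  using assms by (simp add: mat_app_def unit_at_def fun_eq_iff if_distrib cong: if_cong)

lemma mat_app_minus: "mat_app I Y (v - w) = mat_app I Y v - mat_app I Y w"
  by (simp add: mat_app_def fun_eq_iff right_diff_distrib sum_subtractf)

text \<open>The normalised sum is the average of the two points with weights proportional to
  \<open>c\<close> and \<open>d\<close>, hence in the convex set \<open>P\<close>; both weights
  being 0 is treated apart.\<close>

lemma hcone_add:
  assumes "convex P" "f \<in> hcone P" "g \<in> hcone P"
  shows "f + g \<in> hcone P"
proof -
  from assms obtain c x d y where f: "f = hvec c (c *\<^sub>R x)" "c \<ge> 0" "x \<in> P"
    and g: "g = hvec d (d *\<^sub>R y)" "d \<ge> 0" "y \<in> P"
    unfolding hcone_def by auto
  show ?thesis
  proof (cases "c + d = 0")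
    case True
    then have "c = 0" "d = 0" using f g by auto
    then have "f + g = f" by (auto simp: f g hvec_def fun_eq_iff split: option.splits)
    then show ?thesis using assms by simp
  next
    case False
    define z where "z = (c / (c + d)) *\<^sub>R x + (d / (c + d)) *\<^sub>R y"
    have "z \<in> P"
      unfolding z_def using f g False \<open>convex P\<close>
      by (intro convexD) (auto simp: add_divide_distrib [symmetric])
    moreover have "(c + d) *\<^sub>R z = c *\<^sub>R x + d *\<^sub>R y"
      using False by (simp add: z_def scaleR_add_right)
    then have "f + g = hvec (c + d) ((c + d) *\<^sub>R z)"
      by (auto simp: f g hvec_def fun_eq_iff split: option.splits)
    ultimately show ?thesis
      unfolding hcone_def using f(2) g(2) by (blast intro: add_nonneg_nonneg)
  qed
qed

lemma hcone_scaleR: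
  assumes "f \<in> hcone P" "r \<ge> 0"
  shows "r *\<^sub>R f \<in> hcone P"
proof -
  from assms obtain c x where f: "f = hvec c (c *\<^sub>R x)" "c \<ge> 0" "x \<in> P"
    unfolding hcone_def by auto
  have "r *\<^sub>R f = hvec (r * c) ((r * c) *\<^sub>R x)"
    by (auto simp: f hvec_def scaleR_fun_def fun_eq_iff split: option.splits)
  then show ?thesis unfolding hcone_def using f assms by (blast intro: mult_nonneg_nonneg)
qed

text \<open>All conditions on the matrix are linear or are membership in a convex cone; convexity of
  \<open>P\<close> enters only through \<open>hcone_add\<close>.\<close>

lemma convex_LS_plus_hat:
  assumes "convex P"
  shows "convex (LS_plus_hat V P)"
proof (rule convexI)
  fix Y Z :: "'a option \<Rightarrow> 'a option \<Rightarrow> real" and u v :: real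
  assume Y: "Y \<in> LS_plus_hat V P" and Z: "Z \<in> LS_plus_hat V P" and uv: "u \<ge> 0" "v \<ge> 0" "u + v = 1"
  let ?W = "u *\<^sub>R Y + v *\<^sub>R Z"
  have W: "?W i j = u * Y i j + v * Z i j" for i j
    by (simp add: scaleR_fun_def)
  have app: "mat_app I ?W w = u *\<^sub>R mat_app I Y w + v *\<^sub>R mat_app I Z w" for I w
    by (simp add: mat_app_def W scaleR_fun_def fun_eq_iff sum.distrib sum_distrib_left algebra_simps)
  have "mat_on (hidx V) ?W"
    using Y Z by (simp add: LS_plus_hat_def mat_on_def scaleR_fun_def)
  moreover have "sym_psd_on (hidx V) ?W"
  proof -
    have "(\<Sum>i\<in>hidx V. \<Sum>j\<in>hidx V. w i * ?W i j * w j) \<ge> 0" for w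
    proof -
      have "(\<Sum>i\<in>hidx V. \<Sum>j\<in>hidx V. w i * ?W i j * w j) =
          u * (\<Sum>i\<in>hidx V. \<Sum>j\<in>hidx V. w i * Y i j * w j) +
          v * (\<Sum>i\<in>hidx V. \<Sum>j\<in>hidx V. w i * Z i j * w j)"
        unfolding W by (simp add: sum.distrib sum_distrib_left algebra_simps)
      also have "\<dots> \<ge> 0"
        using Y Z uv by (simp add: LS_plus_hat_def sym_psd_on_def)
      finally show ?thesis .
    qed
    moreover have "\<forall>i\<in>hidx V. \<forall>j\<in>hidx V. ?W i j = ?W j i"
    proof (intro ballI)
      fix i j assume "i \<in> hidx V" "j \<in> hidx V"
      then have "Y i j = Y j i" "Z i j = Z j i"
        using Y Z by (auto simp: LS_plus_hat_def sym_psd_on_def)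
      then show "?W i j = ?W j i" by (simp add: scaleR_fun_def)
    qed
    ultimately show ?thesis unfolding sym_psd_on_def by blast
  qed
  moreover have "mat_app (hidx V) ?W (unit_at None) = mat_diag ?W"
  proof -
    have "mat_diag ?W = u *\<^sub>R mat_diag Y + v *\<^sub>R mat_diag Z"
      by (simp add: mat_diag_def W scaleR_fun_def fun_eq_iff)
    then show ?thesis using Y Z by (simp add: app LS_plus_hat_def)
  qed
  moreover have "mat_app (hidx V) ?W (unit_at (Some i)) \<in> hcone P \<and>
      mat_app (hidx V) ?W (unit_at None - unit_at (Some i)) \<in> hcone P" if "i \<in> V" for i
    unfolding app using Y Z uv that
    by (auto simp: LS_plus_hat_def intro!: hcone_add hcone_scaleR assms)
  ultimately show "?W \<in> LS_plus_hat V P" unfolding LS_plus_hat_def by blast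
qed

lemma convex_LS_plus:
  assumes "convex P"
  shows "convex (LS_plus V P)"
proof (rule convexI)
  fix x y :: "'a \<Rightarrow> real" and u v :: real
  assume x: "x \<in> LS_plus V P" and y: "y \<in> LS_plus V P" and uv: "u \<ge> 0" "v \<ge> 0" "u + v = 1"
  from x obtain Y where Y: "Y \<in> LS_plus_hat V P" "mat_app (hidx V) Y (unit_at None) = hvec 1 x"
    by (auto simp: LS_plus_def)
  from y obtain Z where Z: "Z \<in> LS_plus_hat V P" "mat_app (hidx V) Z (unit_at None) = hvec 1 y"
    by (auto simp: LS_plus_def)
  let ?W = "u *\<^sub>R Y + v *\<^sub>R Z"
  have "?W \<in> LS_plus_hat V P"
    using convex_LS_plus_hat[OF assms] Y(1) Z(1) uv by (rule convexD)
  moreover have "mat_app (hidx V) ?W (unit_at None) =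
      u *\<^sub>R mat_app (hidx V) Y (unit_at None) + v *\<^sub>R mat_app (hidx V) Z (unit_at None)"
    by (simp add: mat_app_def scaleR_fun_def fun_eq_iff sum.distrib sum_distrib_left algebra_simps)
  then have "mat_app (hidx V) ?W (unit_at None) = hvec 1 (u *\<^sub>R x + v *\<^sub>R y)"
    using uv unfolding Y Z
    by (auto simp: hvec_def scaleR_fun_def fun_eq_iff split: option.splits)
  ultimately show "u *\<^sub>R x + v *\<^sub>R y \<in> LS_plus V P"
    unfolding LS_plus_def by blast
qed

text \<open>The witness is the rank-one matrix of \<open>z = (1, x)\<close>. Its diagonal is
  \<open>z\<close> because 0 and 1 are idempotent, and the columns to be tested are the multiples
  \<open>x i\<close> and \<open>1 - x i\<close> of \<open>z\<close>.\<close>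

lemma zero_one_in_LS_plus:
  assumes "finite V" "x \<in> P" "\<And>i. x i \<in> {0, 1}" "\<And>i. i \<notin> V \<Longrightarrow> x i = 0"
  shows "x \<in> LS_plus V P"
proof -
  define z where "z = hvec 1 x"
  define Y where "Y = (\<lambda>i j. z i * z j)"
  have z: "z None = 1" "z (Some i) = x i" for i by (auto simp: z_def hvec_def)
  have zz: "z i * z i = z i" for i using assms(3) by (cases i) (auto simp: z)
  have z0: "z i = 0" if "i \<notin> hidx V" for i
    using that assms(4) by (cases i) (auto simp: z)
  have cone: "r *\<^sub>R z \<in> hcone P" if "r \<ge> 0" for r
  proof -
    have "r *\<^sub>R z = hvec r (r *\<^sub>R x)"
      by (auto simp: z_def hvec_def scaleR_fun_def fun_eq_iff split: option.splits)
    then show ?thesis using that assms(2) unfolding hcone_def by blast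
  qed
  have col0: "mat_app (hidx V) Y (unit_at None) = z"
    using assms(1) by (subst mat_app_unit) (auto simp: Y_def z finite_hidx)
  have col: "mat_app (hidx V) Y (unit_at (Some i)) = x i *\<^sub>R z" if "i \<in> V" for i
    using assms(1) that
    by (subst mat_app_unit) (auto simp: Y_def z finite_hidx scaleR_fun_def fun_eq_iff)
  have "Y \<in> LS_plus_hat V P"
  proof -
    have "(\<Sum>i\<in>hidx V. \<Sum>j\<in>hidx V. w i * Y i j * w j) \<ge> 0" for w
    proof -
      have "(\<Sum>i\<in>hidx V. \<Sum>j\<in>hidx V. w i * Y i j * w j) = (\<Sum>i\<in>hidx V. w i * z i)\<^sup>2"
        unfolding power2_eq_square sum_product by (simp add: Y_def algebra_simps)
      then show ?thesis by simp
    qed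
    moreover have "mat_app (hidx V) Y (unit_at None - unit_at (Some i)) \<in> hcone P" if "i \<in> V" for i
    proof -
      have "mat_app (hidx V) Y (unit_at None - unit_at (Some i)) = (1 - x i) *\<^sub>R z"
        unfolding mat_app_minus col0 col[OF that] by (simp add: scaleR_left_diff_distrib)
      moreover have "1 - x i \<ge> 0" using assms(3)[of i] by auto
      ultimately show ?thesis using cone by simp
    qed
    moreover have "x i \<ge> 0" for i using assms(3)[of i] by auto
    moreover have "mat_on (hidx V) Y" "Y i j = Y j i" "mat_diag Y = z" for i j
      by (auto simp: mat_on_def Y_def z0 mat_diag_def zz)
    ultimately show ?thesis
      unfolding LS_plus_hat_def sym_psd_on_def by (auto simp: col0 col cone)
  qed
  then show ?thesis unfolding LS_plus_def using col0 z_def by blast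
qed

text \<open>The scale of column \<open>i\<close> in the cone is its entry in row
  \<open>None\<close>, which is \<open>x i\<close> by symmetry. Writing the column as
  \<open>x i * y j\<close> avoids division: if \<open>x i = 0\<close>, \<open>y\<close> is just some
  point of \<open>P\<close>.\<close>

lemma LS_plusE:
  assumes "x \<in> LS_plus V P" "finite V"
  obtains Y where "sym_psd_on (hidx V) Y" "Y None None = 1"
    "\<And>i. i \<in> V \<Longrightarrow> Y None (Some i) = x i" "\<And>i. i \<in> V \<Longrightarrow> Y (Some i) None = x i"
    "\<And>i. i \<in> V \<Longrightarrow> Y (Some i) (Some i) = x i"
    "\<And>i. i \<in> V \<Longrightarrow> \<exists>y\<in>P. \<forall>j\<in>V. Y (Some j) (Some i) = x i * y j"
    "\<And>i. i \<in> V \<Longrightarrow> 0 \<le> x i" "\<And>i. i \<notin> V \<Longrightarrow> x i = 0"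
proof -
  from assms obtain Y where Y: "Y \<in> LS_plus_hat V P"
    and app: "mat_app (hidx V) Y (unit_at None) = hvec 1 x"
    by (auto simp: LS_plus_def)
  have fin: "finite (hidx V)" using assms by (simp add: finite_hidx)
  have psd: "sym_psd_on (hidx V) Y" using Y by (simp add: LS_plus_hat_def)
  have col0: "Y i None = hvec 1 x i" for i
    using app mat_app_unit[OF fin, of None Y] by (simp add: fun_eq_iff)
  have diag: "Y i i = hvec 1 x i" for i
    using Y app by (simp add: LS_plus_hat_def mat_diag_def fun_eq_iff)
  have row0: "Y None (Some i) = x i" if "i \<in> V" for i
    using psd col0[of "Some i"] that by (auto simp: sym_psd_on_def hvec_def)
  have col: "\<exists>y\<in>P. \<forall>j\<in>V. Y (Some j) (Some i) = x i * y j" and pos: "0 \<le> x i" if "i \<in> V" for i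
  proof -
    have "(\<lambda>k. Y k (Some i)) \<in> hcone P"
      using Y that mat_app_unit[OF fin, of "Some i" Y] unfolding LS_plus_hat_def by auto
    then obtain c y where cy: "(\<lambda>k. Y k (Some i)) = hvec c (c *\<^sub>R y)" "c \<ge> 0" "y \<in> P"
      unfolding hcone_def by blast
    have "c = x i" using fun_cong[OF cy(1), of None] row0[OF that] by (simp add: hvec_def)
    moreover have "Y (Some j) (Some i) = c * y j" for j
      using fun_cong[OF cy(1), of "Some j"] by (simp add: hvec_def scaleR_fun_def)
    ultimately show "\<exists>y\<in>P. \<forall>j\<in>V. Y (Some j) (Some i) = x i * y j" "0 \<le> x i"
      using cy by auto
  qed
  have "x i = 0" if "i \<notin> V" for i
    using Y that diag[of "Some i"] by (simp add: LS_plus_hat_def mat_on_def hvec_def)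
  then show thesis
    using that[OF psd] col0[of None] col0[of "Some _"] diag[of "Some _"] row0 col pos
    by (simp add: hvec_def)
qed

text \<open>Let \<open>s\<close> be the value of \<open>a\<close> at \<open>x\<close> and
  \<open>q\<close> the quadratic form of the lower block at \<open>a\<close>. Column
  \<open>i\<close> is \<open>x i\<close> times a point to which \<open>valid\<close> applies, so
  \<open>q <= b * s\<close>; the test vector then gives
  \<open>0 <= b * b - 2 * b * s + q <= b * (b - s)\<close>.\<close>

lemma LS_plus_valid:
  assumes "finite V" and a: "\<And>i. i \<in> V \<Longrightarrow> a i \<ge> 0" and b: "b > 0"
    and valid: "\<And>i y. i \<in> V \<Longrightarrow> a i > 0 \<Longrightarrow> y \<in> P \<Longrightarrow> y i = 1 \<Longrightarrow> (\<Sum>j\<in>V. a j * y j) \<le> b"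
    and x: "x \<in> LS_plus V P"
  shows "(\<Sum>i\<in>V. a i * x i) \<le> b"
proof -
  obtain Y where Y: "sym_psd_on (hidx V) Y" "Y None None = 1"
    "\<And>i. i \<in> V \<Longrightarrow> Y None (Some i) = x i" "\<And>i. i \<in> V \<Longrightarrow> Y (Some i) None = x i"
    "\<And>i. i \<in> V \<Longrightarrow> Y (Some i) (Some i) = x i"
    and col: "\<And>i. i \<in> V \<Longrightarrow> \<exists>y\<in>P. \<forall>j\<in>V. Y (Some j) (Some i) = x i * y j"
    and x0: "\<And>i. i \<in> V \<Longrightarrow> 0 \<le> x i" "\<And>i. i \<notin> V \<Longrightarrow> x i = 0"
    by (rule LS_plusE[OF x \<open>finite V\<close>]) blast
  define s where "s = (\<Sum>i\<in>V. a i * x i)"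
  define q where "q = (\<Sum>i\<in>V. \<Sum>j\<in>V. a i * Y (Some i) (Some j) * a j)"
  define v where "v = hvec (- b) a"
  have v: "v None = - b" "v (Some i) = a i" for i by (auto simp: v_def hvec_def)
  have le: "a i * (\<Sum>j\<in>V. Y (Some j) (Some i) * a j) \<le> a i * (b * x i)" if i: "i \<in> V" for i
  proof (cases "a i = 0 \<or> x i = 0")
    case True
    then show ?thesis using col[OF i] by auto
  next
    case False
    then have pos: "a i > 0" "x i > 0" using a[OF i] x0(1)[OF i] by auto
    from col[OF i] obtain y where y: "y \<in> P" "\<And>j. j \<in> V \<Longrightarrow> Y (Some j) (Some i) = x i * y j" by auto
    \<comment> \<open>The diagonal entry is both \<open>x i\<close> and
      \<open>x i * y i\<close>.\<close>
    have "y i = 1" using y(2)[OF i] Y(5)[OF i] pos by simp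
    then have "(\<Sum>j\<in>V. a j * y j) \<le> b" using valid i pos y by blast
    moreover have "(\<Sum>j\<in>V. Y (Some j) (Some i) * a j) = x i * (\<Sum>j\<in>V. a j * y j)"
      using y by (simp add: sum_distrib_left algebra_simps)
    ultimately show ?thesis using pos by (simp add: mult.commute)
  qed
  have "q = (\<Sum>i\<in>V. a i * (\<Sum>j\<in>V. Y (Some j) (Some i) * a j))"
  proof -
    have "Y (Some i) (Some j) = Y (Some j) (Some i)" if "i \<in> V" "j \<in> V" for i j
      using Y(1) that by (auto simp: sym_psd_on_def)
    then show ?thesis unfolding q_def by (simp add: sum_distrib_left algebra_simps)
  qed
  also have "\<dots> \<le> (\<Sum>i\<in>V. a i * (b * x i))" by (intro sum_mono le)
  also have "\<dots> = b * s" by (simp add: s_def sum_distrib_left algebra_simps)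
  finally have q: "q \<le> b * s" .
  have "0 \<le> (\<Sum>i\<in>hidx V. \<Sum>j\<in>hidx V. v i * Y i j * v j)"
    using Y(1) by (simp add: sym_psd_on_def)
  also have "\<dots> = b * b + (\<Sum>i\<in>V. - b * (a i * x i)) + ((\<Sum>i\<in>V. - b * (a i * x i)) + q)"
    using \<open>finite V\<close>
    by (simp add: sum_hidx v Y sum.distrib sum_subtractf sum_negf q_def mult.commute mult.left_commute)
  also have "\<dots> = b * b - 2 * b * s + q"
    unfolding sum_distrib_left [symmetric] s_def by simp
  also have "\<dots> \<le> b * (b - s)" using q by (simp add: algebra_simps)
  finally have "b - s \<ge> 0" using b by (simp add: zero_le_mult_iff)
  then show ?thesis by (simp add: s_def)
qed

section \<open>Valid inequalities of the stable set polytope\<close>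

definition stable :: "'a pair_pre_digraph \<Rightarrow> 'a set \<Rightarrow> bool" where
  "stable G S \<longleftrightarrow> S \<subseteq> pverts G \<and> (\<forall>u\<in>S. \<forall>v\<in>S. (u, v) \<notin> parcs G)"

definition clique :: "'a pair_pre_digraph \<Rightarrow> 'a set \<Rightarrow> bool" where
  "clique G K \<longleftrightarrow> K \<subseteq> pverts G \<and> (\<forall>u\<in>K. \<forall>v\<in>K. u \<noteq> v \<longrightarrow> (u, v) \<in> parcs G)"

text \<open>This is the neighbourhood in the complement graph, in which the case of degree 4 is
  analysed.\<close>

definition non_nbrs :: "'a pair_pre_digraph \<Rightarrow> 'a \<Rightarrow> 'a set" where
  "non_nbrs G v = {u \<in> pverts G. u \<noteq> v \<and> (v, u) \<notin> parcs G}"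

definition bipartite_on :: "'a pair_pre_digraph \<Rightarrow> 'a set \<Rightarrow> bool" where
  "bipartite_on G W \<longleftrightarrow> (\<exists>A B. W = A \<union> B \<and> stable G A \<and> stable G B)"

lemma LS_plus_graph_Suc:
  "LS_plus_graph (Suc l) G = LS_plus (pverts G) (LS_plus_graph l G)"
  by (simp add: LS_plus_graph_def)

lemma LS_plus_graph_1: "LS_plus_graph (Suc 0) G = LS_plus (pverts G) (FRAC G)"
  by (simp add: LS_plus_graph_def)

lemma convex_FRAC: "convex (FRAC G)"
proof (rule convexI)
  fix x y :: "'a \<Rightarrow> real" and u v :: real
  assume x: "x \<in> FRAC G" and y: "y \<in> FRAC G" and uv: "u \<ge> 0" "v \<ge> 0" "u + v = 1"
  have "u * x i + v * y i \<le> 1" if "i \<in> pverts G" for i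
    using x y uv that by (intro convex_bound_le) (auto simp: FRAC_def)
  moreover have "(u * x i + v * y i) + (u * x j + v * y j) \<le> 1" if "(i, j) \<in> parcs G" for i j
  proof -
    have "u * (x i + x j) + v * (y i + y j) \<le> 1"
      using x y uv that by (intro convex_bound_le) (auto simp: FRAC_def)
    then show ?thesis by (simp add: algebra_simps)
  qed
  ultimately show "u *\<^sub>R x + v *\<^sub>R y \<in> FRAC G"
    using x y uv by (auto simp: FRAC_def scaleR_fun_def)
qed

text \<open>Every level contains the 0/1 points. Convexity is carried through the same induction,
  since it is what turns containment of these points into containment of their hull.\<close>

lemma STAB_subset_LS_plus_graph:
  assumes "finite (pverts G)"
  shows "STAB G \<subseteq> LS_plus_graph l G"
proof -
  have "convex (LS_plus_graph l G) \<and>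
      {x \<in> FRAC G. \<forall>i\<in>pverts G. x i \<in> {0, 1}} \<subseteq> LS_plus_graph l G"
  proof (induction l)
    case 0
    then show ?case by (simp add: LS_plus_graph_def convex_FRAC)
  next
    case (Suc l)
    then show ?case
      unfolding LS_plus_graph_Suc
      by (auto intro!: convex_LS_plus zero_one_in_LS_plus assms simp: FRAC_def)
  qed
  then show ?thesis unfolding STAB_def by (intro hull_minimal) blast+
qed

text \<open>Hyperplane separation is applied in the Euclidean space \<open>real ^ 'n\<close>, into
  which the coordinates from \<open>V\<close> are carried by \<open>g\<close>. Finiteness of
  \<open>S\<close> makes the hull compact, so the separation is strict.\<close>

lemma separating_functional:
  fixes g :: "'a \<Rightarrow> 'n::finite" and S :: "('a \<Rightarrow> real) set"
  assumes "finite V" "inj_on g V" "finite S"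
    and S: "\<And>y i. y \<in> S \<Longrightarrow> i \<notin> V \<Longrightarrow> y i = 0" and x: "\<And>i. i \<notin> V \<Longrightarrow> x i = 0"
    and notin: "x \<notin> convex hull S"
  shows "\<exists>a b. (\<forall>y\<in>S. (\<Sum>i\<in>V. a i * y i) < b) \<and> b < (\<Sum>i\<in>V. a i * x i)"
proof -
  define L :: "('a \<Rightarrow> real) \<Rightarrow> real ^ 'n"
    where "L y = (\<chi> k. if k \<in> g ` V then y (inv_into V g k) else 0)" for y
  have L: "L y $ g i = y i" if "i \<in> V" for y i
    using that \<open>inj_on g V\<close> by (simp add: L_def)
  have "linear L"
    by (rule linearI) (auto simp: L_def vec_eq_iff scaleR_fun_def)
  have hull0: "y i = 0" if "y \<in> convex hull S" "i \<notin> V" for y i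
  proof -
    have "convex {y :: 'a \<Rightarrow> real. y i = 0}"
      by (rule convexI) (auto simp: scaleR_fun_def)
    then have "convex hull S \<subseteq> {y. y i = 0}"
      using S that(2) by (intro hull_minimal) auto
    then show ?thesis using that by auto
  qed
  have "L x \<notin> convex hull (L ` S)"
  proof
    assume "L x \<in> convex hull (L ` S)"
    then obtain y where y: "y \<in> convex hull S" "L x = L y"
      using convex_hull_linear_image[OF \<open>linear L\<close>, of S] by auto
    have "x = y"
    proof
      fix i show "x i = y i"
        using L[of i x] L[of i y] y hull0[of y i] x[of i] by (cases "i \<in> V") auto
    qed
    then show False using y notin by simp
  qed
  moreover have "closed (convex hull (L ` S))"
    using \<open>finite S\<close> by (simp add: compact_imp_closed finite_imp_compact_convex_hull)
  ultimately obtain c d where cd: "inner c (L x) < d" "\<And>z. z \<in> convex hull (L ` S) \<Longrightarrow> inner c z > d"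
    using separating_hyperplane_closed_point[OF convex_convex_hull] by blast
  have inner: "inner c (L y) = (\<Sum>i\<in>V. c $ g i * y i)" for y
  proof -
    have "inner c (L y) = (\<Sum>k\<in>UNIV. c $ k * L y $ k)" by (simp add: inner_vec_def)
    also have "\<dots> = (\<Sum>k\<in>g ` V. c $ k * L y $ k)"
      by (rule sum.mono_neutral_right) (auto simp: L_def)
    also have "\<dots> = (\<Sum>i\<in>V. c $ g i * y i)"
      using \<open>inj_on g V\<close> by (simp add: sum.reindex L)
    finally show ?thesis .
  qed
  \<comment> \<open>The hyperplane puts \<open>x\<close> below and \<open>S\<close> above; the sign
    change produces an upper bound on \<open>S\<close>.\<close>
  have "(\<Sum>i\<in>V. - c $ g i * y i) < - d" if "y \<in> S" for y
    using cd(2)[of "L y"] that by (simp add: inner sum_negf hull_inc)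
  moreover have "- d < (\<Sum>i\<in>V. - c $ g i * x i)"
    using cd(1) by (simp add: inner sum_negf)
  ultimately show ?thesis by (intro exI[of _ "\<lambda>i. - c $ g i"] exI[of _ "- d"]) simp
qed

lemma sum_le_of_le:
  fixes a x :: "'a \<Rightarrow> real"
  assumes "\<And>i. i \<in> K \<Longrightarrow> a i \<le> m" "\<And>i. i \<in> K \<Longrightarrow> 0 \<le> x i" "sum x K \<le> s" "0 \<le> m"
  shows "(\<Sum>i\<in>K. a i * x i) \<le> m * s"
proof -
  have "(\<Sum>i\<in>K. a i * x i) \<le> (\<Sum>i\<in>K. m * x i)"
    using assms by (intro sum_mono mult_right_mono) auto
  also have "\<dots> \<le> m * s"
    using assms by (simp add: sum_distrib_left [symmetric] mult_left_mono)
  finally show ?thesis .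
qed

context pair_graph
begin

lemma arc_sym: "(u, v) \<in> parcs G \<Longrightarrow> (v, u) \<in> parcs G"
  using pair_sym_arcs by (auto simp: symmetric_def dest: symD)

lemma no_loop [simp]: "(u, u) \<notin> parcs G"
  using pair_no_loops by fastforce

text \<open>STAB contains 0 and is closed under setting coordinates to 0. The first fact makes the
  right-hand side of a separating inequality positive, the second allows its coefficients to be
  replaced by their positive parts.\<close>

lemma in_STAB_if_valid:
  fixes g :: "'a \<Rightarrow> 'n::finite"
  assumes "inj_on g (pverts G)"
    and x: "\<And>i. i \<in> pverts G \<Longrightarrow> 0 \<le> x i" "\<And>i. i \<notin> pverts G \<Longrightarrow> x i = 0"
    and valid: "\<And>a b. (\<And>i. i \<in> pverts G \<Longrightarrow> 0 \<le> a i) \<Longrightarrow> 0 < b \<Longrightarrow>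
      (\<And>T. stable G T \<Longrightarrow> sum a T \<le> b) \<Longrightarrow> (\<Sum>i\<in>pverts G. a i * x i) \<le> b"
  shows "x \<in> STAB G"
proof (rule ccontr)
  define S where "S = {x \<in> FRAC G. \<forall>i\<in>pverts G. x i \<in> {0, 1}}"
  assume "x \<notin> STAB G"
  then have notin: "x \<notin> convex hull S" by (simp add: STAB_def S_def)
  have "S \<subseteq> indicator ` Pow (pverts G)"
  proof
    fix y assume y: "y \<in> S"
    have "y = indicator {i \<in> pverts G. y i = 1}"
    proof
      fix i show "y i = indicator {i \<in> pverts G. y i = 1} i"
        using y by (cases "i \<in> pverts G") (auto simp: S_def FRAC_def)
    qed
    then show "y \<in> indicator ` Pow (pverts G)" by blast
  qed
  then have "finite S" by (rule finite_subset) (simp add: pair_finite_verts)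
  have S0: "y i = 0" if "y \<in> S" "i \<notin> pverts G" for y i
    using that by (simp add: S_def FRAC_def)
  then obtain a b where ab: "\<And>y. y \<in> S \<Longrightarrow> (\<Sum>i\<in>pverts G. a i * y i) < b"
      "b < (\<Sum>i\<in>pverts G. a i * x i)"
    using separating_functional[OF pair_finite_verts assms(1) \<open>finite S\<close> _ x(2) notin] S0 by blast
  define a' where "a' i = max 0 (a i)" for i
  have "0 \<in> S" by (auto simp: S_def FRAC_def)
  then have "0 < b" using ab(1)[of 0] by simp
  have "sum a' T \<le> b" if T: "stable G T" for T
  proof -
    \<comment> \<open>Discarding vertices of nonpositive weight keeps the set stable, so the
      truncated weights on \<open>T\<close> are the original weights on \<open>T'\<close>.\<close>
    define T' where "T' = {i \<in> T. a i > 0}"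
    have sub: "T \<subseteq> pverts G" "T' \<subseteq> pverts G" using T by (auto simp: stable_def T'_def)
    have "indicator T' \<in> S"
      using T by (auto simp: S_def FRAC_def indicator_def stable_def T'_def)
    then have "(\<Sum>i\<in>pverts G. a i * indicator T' i) < b" by (rule ab)
    also have "(\<Sum>i\<in>pverts G. a i * indicator T' i) = sum a T'"
      using sub pair_finite_verts by (intro sum.mono_neutral_cong_right) auto
    also have "sum a T' = sum a' T"
      using sub pair_finite_verts
      by (intro sum.mono_neutral_cong_left) (auto simp: T'_def a'_def finite_subset)
    finally show ?thesis by simp
  qed
  then have "(\<Sum>i\<in>pverts G. a' i * x i) \<le> b"
    using \<open>0 < b\<close> by (intro valid) (auto simp: a'_def)
  moreover have "(\<Sum>i\<in>pverts G. a i * x i) \<le> (\<Sum>i\<in>pverts G. a' i * x i)"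
    using x by (intro sum_mono mult_right_mono) (auto simp: a'_def)
  ultimately show False using ab(2) by simp
qed

text \<open>Once \<open>y i = 1\<close> at a vertex of \<open>K\<close>, the edge constraints make
  \<open>y\<close> vanish on the rest of \<open>K\<close>, which is the premise of
  \<open>LS_plus_valid\<close> for the indicator of \<open>K\<close>.\<close>

lemma clique_valid:
  assumes x: "x \<in> LS_plus (pverts G) (FRAC G)" and K: "clique G K"
  shows "sum x K \<le> 1"
proof -
  have sub: "K \<subseteq> pverts G" using K by (simp add: clique_def)
  then have "finite K" using pair_finite_verts finite_subset by blast
  have ind: "(\<Sum>i\<in>pverts G. indicator K i * y i) = sum y K" for y :: "'a \<Rightarrow> real"
    using sub pair_finite_verts by (intro sum.mono_neutral_cong_right) auto
  have "(\<Sum>i\<in>pverts G. indicator K i * x i) \<le> 1"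
  proof (rule LS_plus_valid[OF pair_finite_verts _ _ _ x])
    fix i y assume "0 < (indicator K i :: real)" and y: "y \<in> FRAC G" "y i = 1"
    then have i: "i \<in> K" by (auto simp: indicator_def split: if_splits)
    have "y j = 0" if "j \<in> K - {i}" for j
    proof -
      have "(i, j) \<in> parcs G" using that i K by (auto simp: clique_def)
      then have "y i + y j \<le> 1" "0 \<le> y j" using y in_arcsD2 by (auto simp: FRAC_def)
      then show ?thesis using y by simp
    qed
    then have "sum y (K - {i}) = 0" by (intro sum.neutral) auto
    then have "sum y K = 1" using i y \<open>finite K\<close> by (simp add: sum.remove[of K i])
    then show "(\<Sum>j\<in>pverts G. indicator K j * y j) \<le> 1" by (simp add: ind)
  qed auto
  then show ?thesis by (simp add: ind)
qed

text \<open>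
  Round \<open>y\<close> at a threshold \<open>\<theta>\<close> chosen uniformly from \<open>[0, 1]\<close>: the vertices of one colour
  class with \<open>y\<^sub>i \<ge> \<theta>\<close> and those of the other with \<open>y\<^sub>i > 1 - \<theta>\<close> form a stable set,
  which contains \<open>i\<close> with probability \<open>y\<^sub>i\<close>.
\<close>

lemma bipartite_valid:
  assumes W: "bipartite_on G W" and y: "y \<in> FRAC G"
    and b: "\<And>T. T \<subseteq> W \<Longrightarrow> stable G T \<Longrightarrow> sum a T \<le> b"
  shows "(\<Sum>i\<in>W. a i * y i) \<le> b"
proof -
  from W obtain A B where AB: "W = A \<union> B" "stable G A" "stable G B" by (auto simp: bipartite_on_def)
  then have WV: "W \<subseteq> pverts G" by (auto simp: stable_def)
  then have "finite W" using pair_finite_verts finite_subset by blast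
  have y01: "0 \<le> y i" "y i \<le> 1" if "i \<in> W" for i using y WV that by (auto simp: FRAC_def)
  \<comment> \<open>\<open>c i\<close> indicates the thresholds that select \<open>i\<close>. For
    the second class the interval is half-open, written as 1 minus a closed initial interval, so
    that \<open>unit\<close> yields both integrals.\<close>
  define c :: "'a \<Rightarrow> real \<Rightarrow> real" where
    "c i \<theta> = (if i \<in> A then (if \<theta> \<in> {0..y i} then 1 else 0)
            else 1 - (if \<theta> \<in> {0..1 - y i} then 1 else 0))" for i \<theta>
  have unit: "((\<lambda>\<theta>::real. if \<theta> \<in> {0..t} then 1 else 0) has_integral t) {0..1}"
    if "0 \<le> t" "t \<le> 1" for t :: real
  proof -
    have "((\<lambda>\<theta>::real. 1 :: real) has_integral t) {0..t}"
      using has_integral_const_real[of "1::real" 0 t] that by simp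
    then show ?thesis
      using that by (subst has_integral_restrict) auto
  qed
  have one: "((\<lambda>\<theta>::real. 1 :: real) has_integral 1) {0..1}"
    using has_integral_const_real[of "1::real" 0 1] by simp
  have c: "(c i has_integral y i) {0..1}" if "i \<in> W" for i
  proof (cases "i \<in> A")
    case True
    then show ?thesis using unit[of "y i"] y01[OF that] unfolding c_def by simp
  next
    case False
    then show ?thesis
      using has_integral_diff[OF one unit[of "1 - y i"]] y01[OF that] unfolding c_def by simp
  qed
  have int: "((\<lambda>\<theta>. \<Sum>i\<in>W. a i * c i \<theta>) has_integral (\<Sum>i\<in>W. a i * y i)) {0..1}"
    using \<open>finite W\<close> c by (intro has_integral_sum has_integral_mult_right) auto
  have const: "((\<lambda>\<theta>::real. b) has_integral b) {0..1}"
    using has_integral_const_real[of b 0 1] by simp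
  show ?thesis
  proof (rule has_integral_le[OF int const])
    fix \<theta> :: real assume "\<theta> \<in> {0..1}"
    define T where "T = {i \<in> W. c i \<theta> = 1}"
    have "stable G T"
      unfolding stable_def
    proof (intro conjI ballI notI)
      show "T \<subseteq> pverts G" using WV by (auto simp: T_def)
      \<comment> \<open>The strict inequality on the second class is essential: an edge with
        \<open>y i + y j = 1\<close> would otherwise have both ends selected at
        \<open>\<theta> = y i\<close>.\<close>
      have mixed: False if "i \<in> T" "j \<in> T" "i \<in> A" "j \<notin> A" "(i, j) \<in> parcs G" for i j
      proof -
        have "\<theta> \<le> y i" "1 - y j < \<theta>"
          using that \<open>\<theta> \<in> {0..1}\<close> by (auto simp: T_def c_def split: if_splits)
        moreover have "y i + y j \<le> 1" using y that(5) by (auto simp: FRAC_def)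
        ultimately show False by simp
      qed
      fix i j assume ij: "i \<in> T" "j \<in> T" "(i, j) \<in> parcs G"
      then have "i \<in> A \<union> B" "j \<in> A \<union> B" using AB by (auto simp: T_def)
      then show False
        using ij AB(2,3) mixed[of i j] mixed[of j i] arc_sym[of i j] unfolding stable_def by blast
    qed
    moreover have "(\<Sum>i\<in>W. a i * c i \<theta>) = sum a T"
      using \<open>finite W\<close> unfolding T_def
      by (intro sum.mono_neutral_cong_right) (auto simp: c_def split: if_splits)
    ultimately show "(\<Sum>i\<in>W. a i * c i \<theta>) \<le> b" using b[of T] by (simp add: T_def)
  qed
qed

section \<open>Sufficient conditions for rank at most 1 or at most 2\<close>

lemma sum_split_at:
  fixes y :: "'a \<Rightarrow> real"
  assumes "v \<in> pverts G" "y v = 1" "\<And>u. (v, u) \<in> parcs G \<Longrightarrow> y u = 0"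
  shows "(\<Sum>i\<in>pverts G. a i * y i) = a v + (\<Sum>i\<in>non_nbrs G v. a i * y i)"
proof -
  have "(\<Sum>i\<in>pverts G. a i * y i) = (\<Sum>i\<in>insert v (non_nbrs G v). a i * y i)"
    using assms pair_finite_verts by (intro sum.mono_neutral_right) (auto simp: non_nbrs_def)
  also have "\<dots> = a v + (\<Sum>i\<in>non_nbrs G v. a i * y i)"
    using assms pair_finite_verts by (subst sum.insert) (auto simp: non_nbrs_def)
  finally show ?thesis .
qed

lemma LS_plus_nonneg:
  assumes "x \<in> LS_plus (pverts G) P"
  shows "i \<in> pverts G \<Longrightarrow> 0 \<le> x i" "i \<notin> pverts G \<Longrightarrow> x i = 0"
  by (rule LS_plusE[OF assms pair_finite_verts]; simp)+

lemma stable_insert: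
  assumes "v \<in> pverts G" "T \<subseteq> non_nbrs G v" "stable G T"
  shows "stable G (insert v T)"
  using assms by (auto simp: stable_def non_nbrs_def dest: arc_sym)

lemma stable_singleton: "v \<in> pverts G \<Longrightarrow> stable G {v}"
  by (simp add: stable_def)

lemma stable_pair:
  assumes "u \<in> pverts G" "v \<in> pverts G" "(u, v) \<notin> parcs G"
  shows "stable G {u, v}"
  using assms by (auto simp: stable_def dest: arc_sym)

text \<open>If \<open>y v = 1\<close>, only \<open>v\<close> and its non-neighbours carry weight.
  Stable sets among the latter extend by \<open>v\<close>, so they weigh at most
  \<open>b - a v\<close>, and on a bipartite graph this bound passes to all of FRAC.\<close>

lemma LS_plus_graph_1_eq_STAB_if_bipartite:
  fixes g :: "'a \<Rightarrow> 'n::finite"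
  assumes g: "inj_on g (pverts G)" and bip: "\<And>v. v \<in> pverts G \<Longrightarrow> bipartite_on G (non_nbrs G v)"
  shows "LS_plus_graph 1 G = STAB G"
proof (rule antisym)
  show "STAB G \<subseteq> LS_plus_graph 1 G" by (rule STAB_subset_LS_plus_graph[OF pair_finite_verts])
  show "LS_plus_graph 1 G \<subseteq> STAB G"
  proof
    fix x assume "x \<in> LS_plus_graph 1 G"
    then have x: "x \<in> LS_plus (pverts G) (FRAC G)" by (simp add: LS_plus_graph_1)
    show "x \<in> STAB G"
    proof (rule in_STAB_if_valid[OF g LS_plus_nonneg[OF x]])
      fix a :: "'a \<Rightarrow> real" and b :: real
      assume a: "\<And>i. i \<in> pverts G \<Longrightarrow> 0 \<le> a i" and "0 < b"
        and b: "\<And>T. stable G T \<Longrightarrow> sum a T \<le> b"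
      show "(\<Sum>i\<in>pverts G. a i * x i) \<le> b"
      proof (rule LS_plus_valid[OF pair_finite_verts a \<open>0 < b\<close> _ x])
        fix v y assume v: "v \<in> pverts G" and y: "y \<in> FRAC G" "y v = 1"
        have "y u = 0" if "(v, u) \<in> parcs G" for u
        proof -
          have "y v + y u \<le> 1" "0 \<le> y u" using y that in_arcsD2 by (auto simp: FRAC_def)
          then show ?thesis using y by simp
        qed
        then have "(\<Sum>i\<in>pverts G. a i * y i) = a v + (\<Sum>i\<in>non_nbrs G v. a i * y i)"
          using v y by (intro sum_split_at) auto
        moreover have "(\<Sum>i\<in>non_nbrs G v. a i * y i) \<le> b - a v"
        proof (rule bipartite_valid[OF bip[OF v] y(1)])
          fix T assume T: "T \<subseteq> non_nbrs G v" "stable G T"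
          have "v \<notin> T" "finite T"
            using T pair_finite_verts finite_subset[of T "pverts G"] by (auto simp: non_nbrs_def stable_def)
          then show "sum a T \<le> b - a v"
            using b[OF stable_insert[OF v T]] by simp
        qed
        ultimately show "(\<Sum>j\<in>pverts G. a j * y j) \<le> b" by simp
      qed
    qed
  qed
qed

text \<open>After one round, \<open>y\<close> satisfies the clique inequality on the non-neighbours
  of \<open>v\<close>, so they contribute at most the weight of a heaviest one, \<open>w\<close>;
  the stable set \<open>{v, w}\<close> bounds \<open>a v + a w\<close> by \<open>b\<close>.\<close>

lemma LS_plus_graph_2_eq_STAB_if_cliques:
  fixes g :: "'a \<Rightarrow> 'n::finite"
  assumes g: "inj_on g (pverts G)" and K: "\<And>v. v \<in> pverts G \<Longrightarrow> clique G (non_nbrs G v)"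
  shows "LS_plus_graph 2 G = STAB G"
proof (rule antisym)
  show "STAB G \<subseteq> LS_plus_graph 2 G" by (rule STAB_subset_LS_plus_graph[OF pair_finite_verts])
  show "LS_plus_graph 2 G \<subseteq> STAB G"
  proof
    fix x assume "x \<in> LS_plus_graph 2 G"
    then have x: "x \<in> LS_plus (pverts G) (LS_plus (pverts G) (FRAC G))"
      by (simp add: LS_plus_graph_def numeral_2_eq_2)
    show "x \<in> STAB G"
    proof (rule in_STAB_if_valid[OF g LS_plus_nonneg[OF x]])
      fix a :: "'a \<Rightarrow> real" and b :: real
      assume a: "\<And>i. i \<in> pverts G \<Longrightarrow> 0 \<le> a i" and "0 < b"
        and b: "\<And>T. stable G T \<Longrightarrow> sum a T \<le> b"
      show "(\<Sum>i\<in>pverts G. a i * x i) \<le> b"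
      proof (rule LS_plus_valid[OF pair_finite_verts a \<open>0 < b\<close> _ x])
        fix v y assume v: "v \<in> pverts G" and y: "y \<in> LS_plus (pverts G) (FRAC G)" "y v = 1"
        let ?W = "non_nbrs G v"
        have W: "?W \<subseteq> pverts G" "finite ?W" using pair_finite_verts by (auto simp: non_nbrs_def)
        have y0: "0 \<le> y u" if "u \<in> pverts G" for u using LS_plus_nonneg[OF y(1)] that by simp
        have "y u = 0" if "(v, u) \<in> parcs G" for u
        proof -
          have "u \<in> pverts G" "u \<noteq> v" using that in_arcsD2 by auto
          moreover from that v this have "clique G {v, u}" by (auto simp: clique_def dest: arc_sym)
          ultimately show ?thesis using clique_valid[OF y(1), of "{v, u}"] y(2) y0[of u] by simp
        qed
        then have "(\<Sum>i\<in>pverts G. a i * y i) = a v + (\<Sum>i\<in>?W. a i * y i)"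
          using v y by (intro sum_split_at) auto
        moreover have "(\<Sum>i\<in>?W. a i * y i) \<le> b - a v"
        proof (cases "?W = {}")
          case True
          then show ?thesis using b[OF stable_singleton[OF v]] by simp
        next
          case False
          then have "Max (a ` ?W) \<in> a ` ?W" using W by (intro Max_in) auto
          then obtain w where w: "w \<in> ?W" "a w = Max (a ` ?W)" by auto
          then have le: "a i \<le> a w" if "i \<in> ?W" for i using that W by simp
          have "(\<Sum>i\<in>?W. a i * y i) \<le> a w * 1"
            using le W w(1) y0 a clique_valid[OF y(1) K[OF v]] by (intro sum_le_of_le) auto
          moreover have "stable G {v, w}" "v \<noteq> w"
            using w(1) v by (auto simp: non_nbrs_def intro!: stable_pair)
          ultimately show ?thesis using b[of "{v, w}"] by simp
        qed
        ultimately show "(\<Sum>j\<in>pverts G. a j * y j) \<le> b" by simp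
      qed
    qed
  qed
qed

text \<open>Take the heaviest vertices \<open>u\<close> and \<open>w\<close> of the two cliques. If
  they are not adjacent, \<open>{u, w}\<close> is stable and the inequalities of \<open>U\<close>
  and \<open>W\<close> suffice. If they are, let \<open>M\<close> and \<open>N\<close> be the second
  largest weights: the weights are dominated by \<open>M\<close> on \<open>U\<close>,
  \<open>N\<close> on \<open>W\<close> and an extra \<open>D\<close> on the edge
  \<open>{u, w}\<close>, and these multipliers add up to at most \<open>b\<close>.\<close>

lemma LS_plus_graph_1_eq_STAB_if_two_cliques:
  fixes g :: "'a \<Rightarrow> 'n::finite"
  assumes g: "inj_on g (pverts G)"
    and UW: "pverts G = U \<union> W" "U \<inter> W = {}" "U \<noteq> {}" "W \<noteq> {}" "clique G U" "clique G W"
    and matching: "\<And>u w w'. u \<in> U \<Longrightarrow> w \<in> W \<Longrightarrow> w' \<in> W \<Longrightarrow>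
        (u, w) \<in> parcs G \<Longrightarrow> (u, w') \<in> parcs G \<Longrightarrow> w = w'"
      "\<And>u u' w. u \<in> U \<Longrightarrow> u' \<in> U \<Longrightarrow> w \<in> W \<Longrightarrow>
        (u, w) \<in> parcs G \<Longrightarrow> (u', w) \<in> parcs G \<Longrightarrow> u = u'"
  shows "LS_plus_graph 1 G = STAB G"
proof (rule antisym)
  show "STAB G \<subseteq> LS_plus_graph 1 G" by (rule STAB_subset_LS_plus_graph[OF pair_finite_verts])
  have fin: "finite U" "finite W" using UW(1) pair_finite_verts by auto
  show "LS_plus_graph 1 G \<subseteq> STAB G"
  proof
    fix x assume "x \<in> LS_plus_graph 1 G"
    then have x: "x \<in> LS_plus (pverts G) (FRAC G)" by (simp add: LS_plus_graph_1)
    have x0: "0 \<le> x i" if "i \<in> U \<union> W" for i using LS_plus_nonneg[OF x] that UW(1) by simp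
    show "x \<in> STAB G"
    proof (rule in_STAB_if_valid[OF g LS_plus_nonneg[OF x]])
      fix a :: "'a \<Rightarrow> real" and b :: real
      assume a: "\<And>i. i \<in> pverts G \<Longrightarrow> 0 \<le> a i" and "0 < b"
        and b: "\<And>T. stable G T \<Longrightarrow> sum a T \<le> b"
      have b1: "a i \<le> b" if "i \<in> U \<union> W" for i
        using b[OF stable_singleton[of i]] that UW(1) by simp
      have b2: "a i + a j \<le> b" if "i \<in> U" "j \<in> W" "(i, j) \<notin> parcs G" for i j
        using b[OF stable_pair[of i j]] that UW(1,2) by (cases "i = j") auto
      have max: "\<exists>k\<in>K. \<forall>i\<in>K. a i \<le> a k" if "finite K" "K \<noteq> {}" for K
      proof -
        have "Max (a ` K) \<in> a ` K" using that by (intro Max_in) auto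
        then obtain k where "k \<in> K" "a k = Max (a ` K)" by auto
        then show ?thesis using that by (intro bexI[of _ k]) auto
      qed
      obtain u where u: "u \<in> U" "\<And>i. i \<in> U \<Longrightarrow> a i \<le> a u" using max[of U] fin UW by blast
      obtain w where w: "w \<in> W" "\<And>i. i \<in> W \<Longrightarrow> a i \<le> a w" using max[of W] fin UW by blast
      have auw: "0 \<le> a u" "0 \<le> a w" using a u(1) w(1) UW(1) by auto
      have total: "(\<Sum>i\<in>pverts G. a i * x i) = (\<Sum>i\<in>U. a i * x i) + (\<Sum>i\<in>W. a i * x i)"
        unfolding UW(1) using fin UW(2) by (rule sum.union_disjoint)
      have xU: "sum x U \<le> 1" and xW: "sum x W \<le> 1" using clique_valid[OF x] UW by auto
      show "(\<Sum>i\<in>pverts G. a i * x i) \<le> b"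
      proof (cases "(u, w) \<in> parcs G")
        case False
        have "(\<Sum>i\<in>U. a i * x i) \<le> a u * 1"
          by (rule sum_le_of_le[OF u(2) x0 xU auw(1)]) auto
        moreover have "(\<Sum>i\<in>W. a i * x i) \<le> a w * 1"
          by (rule sum_le_of_le[OF w(2) x0 xW auw(2)]) auto
        ultimately show ?thesis using total b2[OF u(1) w(1) False] by simp
      next
        case True
        \<comment> \<open>The inserted 0 is the default when \<open>u\<close> is the only vertex of
          \<open>U\<close>; then the bound on \<open>M + a w\<close> comes from the stable set
          \<open>{w}\<close>.\<close>
        define M where "M = Max (insert 0 (a ` (U - {u})))"
        define N where "N = Max (insert 0 (a ` (W - {w})))"
        have M: "a i \<le> M" if "i \<in> U - {u}" for i using fin that by (auto simp: M_def)
        have N: "a i \<le> N" if "i \<in> W - {w}" for i using fin that by (auto simp: N_def)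
        have MN0: "0 \<le> M" "0 \<le> N" using fin by (auto simp: M_def N_def)
        have "M \<in> insert 0 (a ` (U - {u}))" using fin unfolding M_def by (intro Max_in) auto
        then have Mb: "M \<le> a u \<and> M + a w \<le> b"
        proof
          assume "M = 0"
          then show ?thesis using auw b1[of w] w(1) by simp
        next
          assume "M \<in> a ` (U - {u})"
          then obtain i where i: "i \<in> U" "i \<noteq> u" "M = a i" by blast
          then have "(i, w) \<notin> parcs G" using matching(2)[OF u(1) i(1) w(1) True] by blast
          then show ?thesis using i u(2) b2[OF i(1) w(1)] by simp
        qed
        have "N \<in> insert 0 (a ` (W - {w}))" using fin unfolding N_def by (intro Max_in) auto
        then have Nb: "N \<le> a w \<and> a u + N \<le> b"
        proof
          assume "N = 0"
          then show ?thesis using auw b1[of u] u(1) by simp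
        next
          assume "N \<in> a ` (W - {w})"
          then obtain i where i: "i \<in> W" "i \<noteq> w" "N = a i" by blast
          then have "(u, i) \<notin> parcs G" using matching(1)[OF u(1) w(1) i(1) True] by blast
          then show ?thesis using i w(2) b2[OF u(1) i(1)] by simp
        qed
        have "sum x {u, w} \<le> 1"
          using u(1) w(1) arc_sym[OF True] True UW(1)
          by (intro clique_valid[OF x]) (auto simp: clique_def)
        moreover have "u \<noteq> w" using True by auto
        ultimately have edge: "x u + x w \<le> 1" by simp
        have "(\<Sum>i\<in>U - {u}. a i * x i) \<le> M * (1 - x u)"
          using fin(1) u(1) xU x0 M MN0(1) by (intro sum_le_of_le) (simp_all add: sum_diff1)
        then have U: "(\<Sum>i\<in>U. a i * x i) \<le> a u * x u + M * (1 - x u)"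
          using fin(1) u(1) by (simp add: sum.remove[of U u])
        have "(\<Sum>i\<in>W - {w}. a i * x i) \<le> N * (1 - x w)"
          using fin(2) w(1) xW x0 N MN0(2) by (intro sum_le_of_le) (simp_all add: sum_diff1)
        then have W: "(\<Sum>i\<in>W. a i * x i) \<le> a w * x w + N * (1 - x w)"
          using fin(2) w(1) by (simp add: sum.remove[of W w])
        \<comment> \<open>With this choice \<open>M + N + D\<close> is the larger of
          \<open>a u + N\<close> and \<open>a w + M\<close>, both at most \<open>b\<close> because
          the matching leaves \<open>u\<close> and \<open>w\<close> no further cross edges.\<close>
        define D where "D = max (a u - M) (a w - N)"
        have D: "a u - M \<le> D" "a w - N \<le> D" "0 \<le> D" using Mb by (auto simp: D_def)
        have "(a u - M) * x u \<le> D * x u" "(a w - N) * x w \<le> D * x w" "D * (x u + x w) \<le> D * 1"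
          using x0[of u] x0[of w] u(1) w(1) edge D by (intro mult_right_mono mult_left_mono; simp)+
        then have "(a u - M) * x u + (a w - N) * x w \<le> D" by (simp add: algebra_simps)
        moreover have "M + N + D \<le> b" using Mb Nb by (auto simp: D_def)
        ultimately show ?thesis using total U W by (simp add: algebra_simps)
      qed
    qed
  qed
qed

end

section \<open>Isomorphisms\<close>

text \<open>An arc of a pair graph is determined by its ends, so the vertex map alone describes an
  isomorphism and the arc map of the digraph isomorphism can be reconstructed.\<close>

definition arc_iso :: "('a \<Rightarrow> 'b) \<Rightarrow> 'a pair_pre_digraph \<Rightarrow> 'b pair_pre_digraph \<Rightarrow> bool" where
  "arc_iso f G H \<longleftrightarrow> bij_betw f (pverts G) (pverts H) \<and>
     (\<forall>u\<in>pverts G. \<forall>v\<in>pverts G. (u, v) \<in> parcs G \<longleftrightarrow> (f u, f v) \<in> parcs H)"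

lemma arc_iso_if_digraph_isomorphism:
  assumes "pair_wf_digraph G" "pre_digraph.digraph_isomorphism (with_proj G) h"
    "app_iso h (with_proj G) = with_proj H"
  shows "arc_iso (iso_verts h) G H"
proof -
  let ?f = "iso_verts h"
  have H: "pverts H = ?f ` pverts G" "parcs H = iso_arcs h ` parcs G" "iso_tail h = fst" "iso_head h = snd"
    using assms(3) by (auto simp: with_proj_def app_iso_def)
  have inj: "inj_on ?f (pverts G)"
    using assms(2) by (simp add: pre_digraph.digraph_isomorphism_def)
  have arcs: "iso_arcs h e = (?f (fst e), ?f (snd e))" if "e \<in> parcs G" for e
    using assms(2) that unfolding pre_digraph.digraph_isomorphism_def H
    by (simp add: prod_eq_iff)
  have "(u, v) \<in> parcs G \<longleftrightarrow> (?f u, ?f v) \<in> parcs H" if "u \<in> pverts G" "v \<in> pverts G" for u v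
  proof
    assume "(u, v) \<in> parcs G"
    then show "(?f u, ?f v) \<in> parcs H" using arcs[of "(u, v)"] H(2) by force
  next
    assume "(?f u, ?f v) \<in> parcs H"
    then obtain e where e: "e \<in> parcs G" "(?f u, ?f v) = (?f (fst e), ?f (snd e))"
      using H(2) arcs by auto
    then have "fst e \<in> pverts G" "snd e \<in> pverts G"
      using pair_wf_digraph.arc_fst_in_verts[OF assms(1)] pair_wf_digraph.arc_snd_in_verts[OF assms(1)]
      by auto
    then have "u = fst e" "v = snd e" using e(2) inj that by (auto dest: inj_onD)
    then show "(u, v) \<in> parcs G" using e(1) by simp
  qed
  then show ?thesis using inj H(1) by (simp add: arc_iso_def bij_betw_def)
qed

lemma digraph_isomorphism_if_arc_iso:
  assumes G: "pair_wf_digraph G" and H: "pair_wf_digraph H" and f: "arc_iso f G H"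
  shows "\<exists>h. pre_digraph.digraph_isomorphism (with_proj G) h \<and>
    app_iso h (with_proj G) = with_proj H \<and> iso_verts h = f"
proof -
  define h where "h = \<lparr>iso_verts = f, iso_arcs = map_prod f f, iso_head = snd, iso_tail = fst\<rparr>"
  have inj: "inj_on f (pverts G)" and img: "pverts H = f ` pverts G"
    using f by (auto simp: arc_iso_def bij_betw_def)
  have sub: "parcs G \<subseteq> pverts G \<times> pverts G" "parcs H \<subseteq> pverts H \<times> pverts H"
    using G H by (force simp: pair_wf_digraph_def)+
  have "map_prod f f ` parcs G = parcs H"
  proof (intro equalityI subsetI)
    fix e assume "e \<in> map_prod f f ` parcs G"
    then show "e \<in> parcs H" using f sub by (auto simp: arc_iso_def)
  next
    fix e assume e: "e \<in> parcs H"
    then obtain u v where uv: "e = (f u, f v)" "u \<in> pverts G" "v \<in> pverts G" using sub img by blast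
    then have "(u, v) \<in> parcs G" using e f by (simp add: arc_iso_def)
    then show "e \<in> map_prod f f ` parcs G" using uv by force
  qed
  moreover have "inj_on (map_prod f f) (parcs G)"
    using map_prod_inj_on[OF inj inj] sub inj_on_subset by blast
  moreover have "wf_digraph (with_proj G)"
    using G by (simp add: wf_digraph_def pair_wf_digraph_def)
  ultimately show ?thesis
    using inj img
    by (intro exI[of _ h])
      (auto simp: h_def pre_digraph.digraph_isomorphism_def app_iso_def with_proj_def)
qed

lemma graph_iso_iff:
  assumes "pair_wf_digraph G" "pair_wf_digraph H"
  shows "graph_iso G H \<longleftrightarrow> (\<exists>f. arc_iso f G H)"
proof
  assume "graph_iso G H"
  then obtain h where "pre_digraph.digraph_isomorphism (with_proj G) h"
      "app_iso h (with_proj G) = with_proj H"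
    unfolding graph_iso_def digraph_iso_def by auto
  then show "\<exists>f. arc_iso f G H" using arc_iso_if_digraph_isomorphism[OF assms(1)] by blast
next
  assume "\<exists>f. arc_iso f G H"
  then obtain h where "pre_digraph.digraph_isomorphism (with_proj G) h"
      "with_proj H = app_iso h (with_proj G)"
    using digraph_isomorphism_if_arc_iso[OF assms] by metis
  then show "graph_iso G H" unfolding graph_iso_def digraph_iso_def by blast
qed

lemma vertex_transitive_iff:
  assumes "pair_wf_digraph G"
  shows "vertex_transitive G \<longleftrightarrow>
    (\<forall>u\<in>pverts G. \<forall>v\<in>pverts G. \<exists>h. arc_iso h G G \<and> h u = v)"
proof -
  have "(\<exists>h. pre_digraph.digraph_isomorphism (with_proj G) h \<and>
      app_iso h (with_proj G) = with_proj G \<and> iso_verts h u = v) \<longleftrightarrow>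
    (\<exists>h. arc_iso h G G \<and> h u = v)" for u v
    using arc_iso_if_digraph_isomorphism[OF assms, of _ G]
      digraph_isomorphism_if_arc_iso[OF assms assms] by blast
  then show ?thesis unfolding vertex_transitive_def by simp
qed

lemma arc_iso_comp: "arc_iso f G H \<Longrightarrow> arc_iso g H K \<Longrightarrow> arc_iso (g \<circ> f) G K"
  unfolding arc_iso_def by (auto simp: bij_betw_apply bij_betw_trans)

lemma arc_iso_inv_into:
  assumes "arc_iso f G H"
  shows "arc_iso (inv_into (pverts G) f) H G"
proof -
  have bij: "bij_betw f (pverts G) (pverts H)" using assms by (simp add: arc_iso_def)
  note inv = bij_betw_inv_into[OF bij]
  have "(u, v) \<in> parcs H \<longleftrightarrow> (inv_into (pverts G) f u, inv_into (pverts G) f v) \<in> parcs G"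
    if "u \<in> pverts H" "v \<in> pverts H" for u v
    using assms that bij_betw_apply[OF inv] by (simp add: arc_iso_def bij_betw_inv_into_right[OF bij])
  then show ?thesis using inv by (simp add: arc_iso_def)
qed

text \<open>Automorphisms of \<open>H\<close> are conjugated by \<open>f\<close>.\<close>

lemma vertex_transitive_if_arc_iso:
  assumes f: "arc_iso f G H" and "pair_wf_digraph G" "pair_wf_digraph H" "vertex_transitive H"
  shows "vertex_transitive G"
  unfolding vertex_transitive_iff[OF \<open>pair_wf_digraph G\<close>]
proof (intro ballI)
  fix u v assume uv: "u \<in> pverts G" "v \<in> pverts G"
  have bij: "bij_betw f (pverts G) (pverts H)" using f by (simp add: arc_iso_def)
  then obtain h where h: "arc_iso h H H" "h (f u) = f v"
    using assms uv bij_betw_apply[OF bij] vertex_transitive_iff[of H] by metis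
  have "arc_iso (inv_into (pverts G) f \<circ> (h \<circ> f)) G G"
    by (intro arc_iso_comp[OF _ arc_iso_inv_into[OF f]] arc_iso_comp[OF f h(1)])
  moreover have "(inv_into (pverts G) f \<circ> (h \<circ> f)) u = v"
    using h(2) uv bij by (simp add: bij_betw_inv_into_left)
  ultimately show "\<exists>h. arc_iso h G G \<and> h u = v" by blast
qed

lemma vertex_transitive_circulant:
  assumes "S \<subseteq> {1..n}"
  shows "vertex_transitive (circulant n S)"
proof -
  interpret pair_graph "circulant n S" by (rule pair_graph_circulant[OF assms])
  \<comment> \<open>Rotation by an integer \<open>s\<close>, negative for the inverse. Vertices
    start at 1, hence the shift by one before and after reduction.\<close>
  define rot where "rot s i = nat ((int i + s - 1) mod int n) + 1" for s i
  have rot_int: "int (rot s i) = (int i + s - 1) mod int n + 1" if "n > 0" for s i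
    using that by (simp add: rot_def)
  have rot_rot: "rot s (rot t i) = i" if i: "i \<in> {1..n}" and st: "s + t = 0" for s t i
  proof -
    have n: "n > 0" using i by simp
    have "int (rot s (rot t i)) = ((int i + t - 1) mod int n + 1 + s - 1) mod int n + 1"
      using n by (simp add: rot_int)
    also have "\<dots> = (int i - 1) mod int n + 1"
      using st by (simp add: mod_simps algebra_simps eq_neg_iff_add_eq_0 [symmetric])
    also have "\<dots> = int i" using i by simp
    finally show ?thesis by simp
  qed
  have rot_in: "rot s i \<in> {1..n}" if "i \<in> {1..n}" for s i
  proof -
    have "(int i + s - 1) mod int n < int n" using that by simp
    then show ?thesis using that by (simp add: rot_def Suc_le_eq nat_less_iff)
  qed
  have diff: "(int (rot s j) - int (rot s i)) mod int n = (int j - int i) mod int n" if "n > 0" for s i j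
    using that by (simp add: rot_int mod_simps)
  have iso: "arc_iso (rot s) (circulant n S) (circulant n S)" for s
    unfolding arc_iso_def
  proof (intro conjI ballI)
    show "bij_betw (rot s) (pverts (circulant n S)) (pverts (circulant n S))"
      by (rule bij_betw_byWitness[where f' = "rot (- s)"])
        (use rot_rot rot_in in \<open>auto simp: circulant_def\<close>)
    fix i j assume "i \<in> pverts (circulant n S)" "j \<in> pverts (circulant n S)"
    then have ij: "i \<in> {1..n}" "j \<in> {1..n}" by (auto simp: circulant_def)
    then have "n > 0" by simp
    from diff[OF this, of s j i] diff[OF this, of s i j]
    show "(i, j) \<in> parcs (circulant n S) \<longleftrightarrow> (rot s i, rot s j) \<in> parcs (circulant n S)"
      using ij rot_in by (simp add: circulant_def)
  qed
  have "rot (int v - int u) u = v" if "v \<in> {1..n}" for u v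
    using that by (auto simp: rot_def)
  then show ?thesis
    using iso unfolding vertex_transitive_iff[OF pair_wf_digraph_axioms]
    by (force simp: circulant_def)
qed

section \<open>The squared 8-cycle\<close>

text \<open>6 and 7 are -2 and -1 modulo 8, so one residue accounts for both directions of an
  edge.\<close>

lemma circulant_8_arc:
  assumes "i \<in> {1..8}" "j \<in> {1..8}"
  shows "(i, j) \<in> parcs (circulant 8 {1, 2}) \<longleftrightarrow> (int j - int i) mod 8 \<in> {1, 2, 6, 7}"
proof -
  have "(int i - int j) mod 8 = (- ((int j - int i) mod 8)) mod 8" by (simp add: mod_simps)
  moreover have "(int j - int i) mod 8 \<in> {0, 1, 2, 3, 4, 5, 6, 7}"
    by (simp, presburger)
  ultimately show ?thesis using assms by (auto simp: circulant_def)
qed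

text \<open>
  The circulant matrix \<open>C\<close> with entries \<open>1\<close>, \<open>1/2\<close>, \<open>1/4\<close> at the differences \<open>0\<close>, \<open>\<plusminus>3\<close>, \<open>4\<close> has
  smallest eigenvalue \<open>3/4 - sqrt 2 / 2 > 0\<close> and row sums \<open>9/4\<close>, so \<open>C - (9/32) J\<close> is positive
  semidefinite, where \<open>J\<close> is the all-ones matrix.
\<close>

definition circ_entry :: "int \<Rightarrow> real" where
  "circ_entry r = (if r = 0 then 1 else if r = 3 \<or> r = 5 then 1 / 2 else if r = 4 then 1 / 4 else 0)"

lemma circ_form_psd:
  fixes u :: "nat \<Rightarrow> real"
  shows "9 / 32 * (\<Sum>k\<in>{1..8}. u k)\<^sup>2 \<le>
    (\<Sum>k\<in>{1..8}. \<Sum>l\<in>{1..8}. u k * circ_entry ((int l - int k) mod 8) * u l)"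
proof -
  have set: "{1..8::nat} = {1, 2, 3, 4, 5, 6, 7, 8}" by auto
  define a b c d e f g h where defs: "a = u 1" "b = u 2" "c = u 3" "d = u 4"
    "e = u 5" "f = u 6" "g = u 7" "h = u 8"
  have sum: "(\<Sum>k\<in>{1..8}. u k) = a + b + c + d + e + f + g + h"
    unfolding set by (simp add: defs)
  have form: "(\<Sum>k\<in>{1..8}. \<Sum>l\<in>{1..8}. u k * circ_entry ((int l - int k) mod 8) * u l) =
      a * a + b * b + c * c + d * d + e * e + f * f + g * g + h * h
      + a * d + b * e + c * f + d * g + e * h + f * a + g * b + h * c
      + (a * e + b * f + c * g + d * h) / 2"
    unfolding set by (simp add: circ_entry_def defs algebra_simps)
  \<comment> \<open>Decomposition by frequency. Removing 9/32 times the squared sum cancels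
    frequency 0 exactly; the first square is frequency 4, the next two are frequency 2. The odd
    frequencies depend on the antipodal differences only; completing squares there, instead of
    diagonalising, avoids \<open>sqrt 2\<close> and leaves \<open>3/4 - 2/3 = 1/12\<close>.\<close>
  have "a * a + b * b + c * c + d * d + e * e + f * f + g * g + h * h
      + a * d + b * e + c * f + d * g + e * h + f * a + g * b + h * c
      + (a * e + b * f + c * g + d * h) / 2 - 9 / 32 * (a + b + c + d + e + f + g + h)\<^sup>2 =
      (((h + d + f + b) - (c + g + a + e))\<^sup>2 / 16 + 5 / 8 * (h + d - f - b)\<^sup>2 + 5 / 8 * (c + g - a - e)\<^sup>2
      + 3 / 4 * ((h - d) + 2 / 3 * ((c - g) - (a - e)))\<^sup>2 + 3 / 4 * ((f - b) + 2 / 3 * ((c - g) + (a - e)))\<^sup>2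
      + ((c - g)\<^sup>2 + (a - e)\<^sup>2) / 12) / 2"
    by (simp add: power2_eq_square field_simps)
  moreover have "\<dots> \<ge> 0" by simp
  ultimately show ?thesis unfolding sum form by linarith
qed

text \<open>This puts the columns of \<open>C\<close> into FRAC: residue 0, of weight 1, is adjacent
  only to residues of weight 0, and the residues 3, 4, 5 carry at most 1/2 each.\<close>

lemma circ_entry_add_le:
  assumes "p \<in> {0, 1, 2, 3, 4, 5, 6, 7}" "q \<in> {0, 1, 2, 3, 4, 5, 6, 7}"
  shows "(q - p) mod 8 \<in> {1, 2, 6, 7} \<longrightarrow> circ_entry p + circ_entry q \<le> 1"
  using assms by (elim insertE emptyE) (simp_all add: circ_entry_def)

lemma circ_entry_arc:
  fixes i j k :: nat
  assumes "(int k - int j) mod 8 \<in> {1, 2, 6, 7}"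
  shows "circ_entry ((int j - int i) mod 8) + circ_entry ((int k - int i) mod 8) \<le> 1"
proof -
  define p q where "p = (int j - int i) mod 8" "q = (int k - int i) mod 8"
  have "(q - p) mod 8 = (int k - int j) mod 8" by (simp add: p_q_def mod_simps)
  then have "(q - p) mod 8 \<in> {1, 2, 6, 7}" using assms by simp
  moreover have "p \<in> {0, 1, 2, 3, 4, 5, 6, 7}" "q \<in> {0, 1, 2, 3, 4, 5, 6, 7}"
    unfolding p_q_def by (simp, presburger)+
  ultimately show ?thesis
    unfolding p_q_def [symmetric] using circ_entry_add_le by blast
qed

lemma circ_entry_bounds: "0 \<le> circ_entry r" "circ_entry r \<le> 1"
  by (auto simp: circ_entry_def)

lemma circ_entry_sym: "circ_entry ((int i - int j) mod 8) = circ_entry ((int j - int i) mod 8)"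
proof -
  define p where "p = (int j - int i) mod 8"
  have "(int i - int j) mod 8 = (- p) mod 8" by (simp add: p_def mod_simps)
  moreover have "p \<in> {0, 1, 2, 3, 4, 5, 6, 7}" unfolding p_def by (simp, presburger)
  ultimately show ?thesis unfolding p_def [symmetric] by (auto simp: circ_entry_def)
qed

context pair_graph
begin

text \<open>The matrix has border \<open>x\<close> and lower block \<open>9/32 * C\<close>; each
  column \<open>Some i\<close> is 9/32 times the homogenised column of \<open>C\<close>.\<close>

lemma circulant_8_witness:
  assumes f: "arc_iso f G (circulant 8 {1, 2})"
  shows "(\<lambda>i. if i \<in> pverts G then 9 / 32 else 0) \<in> LS_plus (pverts G) (FRAC G)"
proof -
  define V where "V = pverts G"
  define x :: "'a \<Rightarrow> real" where "x i = (if i \<in> V then 9 / 32 else 0)" for i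
  define C where "C i j = circ_entry ((int (f j) - int (f i)) mod 8)" for i j
  define y where "y i j = (if j \<in> V then C i j else 0)" for i j
  \<comment> \<open>Normalising the difference of columns \<open>None\<close> and
    \<open>Some i\<close>, whose leading entry is \<open>1 - 9/32 = 23/32\<close>, gives the factor
    \<open>(9/32) / (23/32) = 9/23\<close>. As this is below 1/2, every edge constraint
    holds.\<close>
  define z where "z i j = (if j \<in> V then 9 / 23 * (1 - C i j) else 0)" for i j
  define Y :: "'a option \<Rightarrow> 'a option \<Rightarrow> real" where
    "Y p q = (case (p, q) of (None, None) \<Rightarrow> 1 | (None, Some j) \<Rightarrow> x j | (Some i, None) \<Rightarrow> x i
       | (Some i, Some j) \<Rightarrow> if i \<in> V \<and> j \<in> V then 9 / 32 * C i j else 0)" for p q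
  have Y [simp]: "Y None None = 1" "Y None (Some j) = x j" "Y (Some i) None = x i"
    "Y (Some i) (Some j) = (if i \<in> V \<and> j \<in> V then 9 / 32 * C i j else 0)" for i j
    by (auto simp: Y_def)
  have bij: "bij_betw f V {1..8}" using f by (simp add: arc_iso_def circulant_def V_def)
  have fin: "finite V" by (simp add: V_def pair_finite_verts)
  have arc: "(int (f j) - int (f i)) mod 8 \<in> {1, 2, 6, 7}" if "(i, j) \<in> parcs G" for i j
  proof -
    have "i \<in> V" "j \<in> V" using that wellformed' by (auto simp: V_def)
    then have "(f i, f j) \<in> parcs (circulant 8 {1, 2})" "f i \<in> {1..8}" "f j \<in> {1..8}"
      using f that bij_betw_apply[OF bij] by (auto simp: arc_iso_def V_def)
    then show ?thesis using circulant_8_arc by blast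
  qed
  have C01: "0 \<le> C i j" "C i j \<le> 1" for i j by (simp_all add: C_def circ_entry_bounds)
  have Csym: "C i j = C j i" for i j unfolding C_def by (rule circ_entry_sym)
  have Cdiag: "C i i = 1" for i by (simp add: C_def circ_entry_def)
  have yF: "y i \<in> FRAC G" for i
    using C01 circ_entry_arc[OF arc] wellformed'
    by (auto simp: FRAC_def y_def V_def C_def)
  have zF: "z i \<in> FRAC G" for i
  proof -
    have "0 \<le> z i j" "z i j \<le> 1 / 2" for j using C01[of i j] by (auto simp: z_def)
    moreover from this have "z i j \<le> 1" "z i j + z i k \<le> 1" for j k
      by (smt (verit) field_sum_of_halves)+
    moreover have "z i j = 0" if "j \<notin> V" for j using that by (simp add: z_def)
    ultimately show ?thesis by (auto simp: FRAC_def V_def)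
  qed
  have col0: "mat_app (hidx V) Y (unit_at None) = hvec 1 x"
    using fin by (auto simp: mat_app_unit finite_hidx hvec_def fun_eq_iff split: option.splits)
  have col: "mat_app (hidx V) Y (unit_at (Some i)) = hvec (9 / 32) ((9 / 32) *\<^sub>R y i)" if "i \<in> V" for i
    using fin that
    by (auto simp: mat_app_unit finite_hidx hvec_def fun_eq_iff x_def y_def scaleR_fun_def Csym
        split: option.splits)
  have col': "mat_app (hidx V) Y (unit_at None - unit_at (Some i)) = hvec (23 / 32) ((23 / 32) *\<^sub>R z i)"
    if "i \<in> V" for i
    unfolding mat_app_minus col0 col[OF that] using that
    by (auto simp: hvec_def fun_eq_iff x_def y_def z_def scaleR_fun_def field_simps
        split: option.splits)
  have psd: "0 \<le> (\<Sum>p\<in>hidx V. \<Sum>q\<in>hidx V. v p * Y p q * v q)" for v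
  proof -
    define u where "u k = v (Some (inv_into V f k))" for k
    have u: "u (f i) = v (Some i)" if "i \<in> V" for i
      using bij that by (simp add: u_def bij_betw_inv_into_left)
    have s: "(\<Sum>k\<in>{1..8}. u k) = (\<Sum>i\<in>V. v (Some i))"
      using sum.reindex_bij_betw[OF bij, of u] by (simp add: u)
    define F where "F k l = u k * circ_entry ((int l - int k) mod 8) * u l" for k l
    have "(\<Sum>k\<in>{1..8}. \<Sum>l\<in>{1..8}. F k l) = (\<Sum>i\<in>V. \<Sum>l\<in>{1..8}. F (f i) l)"
      by (rule sum.reindex_bij_betw[OF bij, symmetric])
    also have "\<dots> = (\<Sum>i\<in>V. \<Sum>j\<in>V. F (f i) (f j))"
      by (intro sum.cong refl sum.reindex_bij_betw[OF bij, symmetric])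
    also have "\<dots> = (\<Sum>i\<in>V. \<Sum>j\<in>V. v (Some i) * C i j * v (Some j))"
      by (simp add: F_def u C_def)
    finally have q: "9 / 32 * (\<Sum>i\<in>V. v (Some i))\<^sup>2 \<le> (\<Sum>i\<in>V. \<Sum>j\<in>V. v (Some i) * C i j * v (Some j))"
      using circ_form_psd[of u] unfolding s F_def by linarith
    have "(\<Sum>p\<in>hidx V. \<Sum>q\<in>hidx V. v p * Y p q * v q) =
        v None * v None + (\<Sum>i\<in>V. 9 / 32 * v None * v (Some i)) + (\<Sum>i\<in>V. 9 / 32 * v None * v (Some i))
        + (\<Sum>i\<in>V. \<Sum>j\<in>V. 9 / 32 * (v (Some i) * C i j * v (Some j)))"
      using fin by (simp add: sum_hidx sum.distrib x_def mult.commute mult.left_commute)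
    then have eq: "(\<Sum>p\<in>hidx V. \<Sum>q\<in>hidx V. v p * Y p q * v q) =
        v None * v None + 9 / 32 * v None * (\<Sum>i\<in>V. v (Some i)) + 9 / 32 * v None * (\<Sum>i\<in>V. v (Some i))
        + 9 / 32 * (\<Sum>i\<in>V. \<Sum>j\<in>V. v (Some i) * C i j * v (Some j))"
      by (simp only: sum_distrib_left [symmetric])
    \<comment> \<open>Completing the square in \<open>v None\<close> leaves 9/32 times the
      difference bounded below in \<open>q\<close>.\<close>
    have "0 \<le> (v None + 9 / 32 * (\<Sum>i\<in>V. v (Some i)))\<^sup>2" by simp
    then show ?thesis unfolding eq using q by (simp add: power2_eq_square algebra_simps)
  qed
  have "Y \<in> LS_plus_hat V (FRAC G)"
    unfolding LS_plus_hat_def mem_Collect_eq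
  proof (intro conjI ballI)
    show "mat_on (hidx V) Y"
      unfolding mat_on_def
    proof (intro allI impI)
      fix p q assume "p \<notin> hidx V \<or> q \<notin> hidx V"
      then show "Y p q = 0" by (cases p; cases q) (auto simp: x_def)
    qed
    have "Y p q = Y q p" for p q by (cases p; cases q) (auto simp: Csym)
    then show "sym_psd_on (hidx V) Y" using psd by (simp add: sym_psd_on_def)
    show "mat_app (hidx V) Y (unit_at None) = mat_diag Y"
      unfolding col0 by (auto simp: mat_diag_def hvec_def fun_eq_iff Cdiag x_def split: option.splits)
    fix i assume "i \<in> V"
    show "mat_app (hidx V) Y (unit_at (Some i)) \<in> hcone (FRAC G)"
      unfolding col[OF \<open>i \<in> V\<close>] hcone_def using yF by fastforce
    show "mat_app (hidx V) Y (unit_at None - unit_at (Some i)) \<in> hcone (FRAC G)"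
      unfolding col'[OF \<open>i \<in> V\<close>] hcone_def using zF by fastforce
  qed
  then have "x \<in> LS_plus V (FRAC G)" unfolding LS_plus_def using col0 by blast
  then show ?thesis unfolding V_def x_def by simp
qed

text \<open>The non-neighbours of \<open>v\<close> lie at differences 3, 4, 5, which differ from
  each other by 1 or 2.\<close>

lemma circulant_8_non_nbrs_clique:
  assumes f: "arc_iso f G (circulant 8 {1, 2})" and v: "v \<in> pverts G"
  shows "clique G (non_nbrs G v)"
  unfolding clique_def
proof (intro conjI ballI impI)
  show "non_nbrs G v \<subseteq> pverts G" by (auto simp: non_nbrs_def)
  have bij: "bij_betw f (pverts G) {1..8}" using f by (simp add: arc_iso_def circulant_def)
  have arc: "(i, j) \<in> parcs G \<longleftrightarrow> (int (f j) - int (f i)) mod 8 \<in> {1, 2, 6, 7}"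
    if "i \<in> pverts G" "j \<in> pverts G" for i j
  proof -
    have "f i \<in> {1..8}" "f j \<in> {1..8}" using that bij_betw_apply[OF bij] by auto
    then show ?thesis using f that circulant_8_arc by (simp add: arc_iso_def)
  qed
  have eq: "i = j" if "i \<in> pverts G" "j \<in> pverts G" "(int (f j) - int (f i)) mod 8 = 0" for i j
  proof -
    have "f i \<in> {1..8}" "f j \<in> {1..8}" using that bij_betw_apply[OF bij] by auto
    then have "f i = f j" using that(3) by (simp, presburger)
    then show ?thesis using bij that by (auto simp: bij_betw_def dest: inj_onD)
  qed
  fix i j assume ij: "i \<in> non_nbrs G v" "j \<in> non_nbrs G v" "i \<noteq> j"
  then have V: "i \<in> pverts G" "j \<in> pverts G" by (auto simp: non_nbrs_def)
  define p q where "p = (int (f i) - int (f v)) mod 8" "q = (int (f j) - int (f v)) mod 8"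
  have pq: "p \<in> {0, 1, 2, 3, 4, 5, 6, 7}" "q \<in> {0, 1, 2, 3, 4, 5, 6, 7}"
    unfolding p_q_def by (simp, presburger)+
  have nb: "(int (f w) - int (f v)) mod 8 \<notin> {0, 1, 2, 6, 7}" if "w \<in> non_nbrs G v" for w
    using eq[OF v, of w] arc[OF v, of w] that by (auto simp: non_nbrs_def)
  have "p \<notin> {0, 1, 2, 6, 7}" "q \<notin> {0, 1, 2, 6, 7}"
    unfolding p_q_def by (rule nb[OF ij(1)], rule nb[OF ij(2)])
  moreover have qp: "(int (f j) - int (f i)) mod 8 = (q - p) mod 8" by (simp add: p_q_def mod_simps)
  moreover have "(q - p) mod 8 \<noteq> 0" using eq[OF V] ij(3) qp by auto
  ultimately have "(int (f j) - int (f i)) mod 8 \<in> {1, 2, 6, 7}" using pq by auto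
  then show "(i, j) \<in> parcs G" using arc[OF V] by simp
qed

lemma circulant_8_not_STAB:
  assumes f: "arc_iso f G (circulant 8 {1, 2})"
  shows "(\<lambda>i. if i \<in> pverts G then 9 / 32 else 0) \<notin> STAB G"
proof
  have "convex {x :: 'a \<Rightarrow> real. (\<Sum>i\<in>pverts G. x i) \<le> 2}"
  proof (rule convexI)
    fix x y :: "'a \<Rightarrow> real" and u v :: real
    assume "x \<in> {x. (\<Sum>i\<in>pverts G. x i) \<le> 2}" "y \<in> {x. (\<Sum>i\<in>pverts G. x i) \<le> 2}"
      and uv: "u \<ge> 0" "v \<ge> 0" "u + v = 1"
    then have "u * (\<Sum>i\<in>pverts G. x i) + v * (\<Sum>i\<in>pverts G. y i) \<le> 2"
      by (intro convex_bound_le) auto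
    then show "u *\<^sub>R x + v *\<^sub>R y \<in> {x. (\<Sum>i\<in>pverts G. x i) \<le> 2}"
      by (simp add: scaleR_fun_def sum.distrib sum_distrib_left)
  qed
  moreover have "(\<Sum>i\<in>pverts G. x i) \<le> 2" if x: "x \<in> FRAC G" "\<forall>i\<in>pverts G. x i \<in> {0, 1}" for x
  proof (cases "\<exists>v\<in>pverts G. x v = 1")
    case True
    then obtain v where v: "v \<in> pverts G" "x v = 1" by blast
    have "x u = 0" if "(v, u) \<in> parcs G" for u
    proof -
      have "x v + x u \<le> 1" "0 \<le> x u" using x(1) that in_arcsD2 by (auto simp: FRAC_def)
      then show ?thesis using v by simp
    qed
    then have "(\<Sum>i\<in>pverts G. 1 * x i) = 1 + (\<Sum>i\<in>non_nbrs G v. 1 * x i)"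
      using v by (intro sum_split_at) auto
    \<comment> \<open>Membership of the 0/1 point in the first level makes the clique inequality
      available for it.\<close>
    moreover have "x \<in> LS_plus (pverts G) (FRAC G)"
      using x by (intro zero_one_in_LS_plus pair_finite_verts) (auto simp: FRAC_def)
    then have "sum x (non_nbrs G v) \<le> 1"
      by (rule clique_valid[OF _ circulant_8_non_nbrs_clique[OF f v(1)]])
    ultimately show ?thesis by simp
  next
    case False
    then have "(\<Sum>i\<in>pverts G. x i) = 0" using x(2) by (intro sum.neutral) auto
    then show ?thesis by simp
  qed
  ultimately have "STAB G \<subseteq> {x. (\<Sum>i\<in>pverts G. x i) \<le> 2}"
    unfolding STAB_def by (intro hull_minimal) auto
  moreover assume "(\<lambda>i. if i \<in> pverts G then 9 / 32 else 0) \<in> STAB G"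
  ultimately have "real (card (pverts G)) * (9 / 32) \<le> 2" by auto
  moreover have "card (pverts G) = 8"
    using f bij_betw_same_card[of f "pverts G" "{1..8}"] by (simp add: arc_iso_def circulant_def)
  ultimately show False by simp
qed

lemma circulant_8_rank:
  assumes f: "arc_iso f G (circulant 8 {1, 2})"
  shows "LS_plus_rank G = 2"
proof -
  let ?x = "\<lambda>i. if i \<in> pverts G then 9 / 32 else 0 :: real"
  have inj: "inj_on f (pverts G)" and img: "f ` pverts G = {1..8}"
    using f by (auto simp: arc_iso_def circulant_def bij_betw_def)
  have "card (pverts G) = 8" using card_image[OF inj] img by simp
  \<comment> \<open>The numeral type \<open>8\<close> has exactly 8 elements and indexes the
    coordinates of the Euclidean space used for separation.\<close>
  then obtain g :: "'a \<Rightarrow> 8" where "inj_on g (pverts G)"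
    using card_le_inj[OF pair_finite_verts, of "UNIV :: 8 set"] by auto
  then have "LS_plus_graph 2 G = STAB G"
    by (rule LS_plus_graph_2_eq_STAB_if_cliques) (rule circulant_8_non_nbrs_clique[OF f])
  moreover have "LS_plus_graph 0 G \<noteq> STAB G"
  proof -
    have "?x \<in> LS_plus_graph 0 G" by (auto simp: LS_plus_graph_def FRAC_def)
    then show ?thesis using circulant_8_not_STAB[OF f] by auto
  qed
  moreover have "LS_plus_graph 1 G \<noteq> STAB G"
    using circulant_8_witness[OF f] circulant_8_not_STAB[OF f] by (auto simp: LS_plus_graph_1)
  moreover have "l = 0 \<or> l = 1" if "l < 2" for l :: nat using that by auto
  ultimately show ?thesis
    unfolding LS_plus_rank_def by (intro Least_equality) (auto simp: not_le [symmetric])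
qed

end

section \<open>Small vertex-transitive graphs\<close>

definition nbrs :: "'a pair_pre_digraph \<Rightarrow> 'a \<Rightarrow> 'a set" where
  "nbrs G v = {u. (v, u) \<in> parcs G}"

definition triangles_at :: "'a pair_pre_digraph \<Rightarrow> 'a \<Rightarrow> 'a set set" where
  "triangles_at G v = {T. clique G T \<and> card T = 3 \<and> v \<in> T}"

lemma arc_iso_clique:
  assumes "arc_iso h G H" "clique G K"
  shows "clique H (h ` K)"
  using assms bij_betw_apply[of h "pverts G" "pverts H"]
  by (fastforce simp: arc_iso_def clique_def subset_iff)

lemma arc_iso_non_nbrs:
  assumes "arc_iso h G H" "v \<in> pverts G"
  shows "non_nbrs H (h v) = h ` non_nbrs G v"
proof -
  have bij: "inj_on h (pverts G)" "pverts H = h ` pverts G"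
    using assms by (auto simp: arc_iso_def bij_betw_def)
  show ?thesis
    using assms bij by (auto simp: arc_iso_def non_nbrs_def inj_on_eq_iff)
qed

context pair_graph
begin

lemma nbrs_subset: "nbrs G v \<subseteq> pverts G"
  by (auto simp: nbrs_def in_arcsD2)

lemma finite_sets [simp]: "finite (nbrs G v)" "finite (non_nbrs G v)"
  using pair_finite_verts finite_subset[OF nbrs_subset] by (auto simp: non_nbrs_def)

lemma card_verts:
  assumes "v \<in> pverts G"
  shows "card (pverts G) = 1 + card (nbrs G v) + card (non_nbrs G v)"
proof -
  have "pverts G = insert v (nbrs G v \<union> non_nbrs G v)"
    using assms nbrs_subset by (auto simp: nbrs_def non_nbrs_def)
  moreover have "nbrs G v \<inter> non_nbrs G v = {}" "v \<notin> nbrs G v \<union> non_nbrs G v"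
    by (auto simp: nbrs_def non_nbrs_def)
  ultimately show ?thesis by (simp add: card_Un_disjoint)
qed

lemma non_nbrs_sym: "u \<in> non_nbrs G v \<Longrightarrow> v \<in> pverts G \<Longrightarrow> v \<in> non_nbrs G u"
  by (auto simp: non_nbrs_def dest: arc_sym)

lemma clique_three:
  assumes "(u, v) \<in> parcs G" "(v, w) \<in> parcs G" "(u, w) \<in> parcs G"
  shows "clique G {u, v, w}" "card {u, v, w} = 3"
proof -
  show "clique G {u, v, w}" using assms wellformed' by (auto simp: clique_def dest: arc_sym)
  have "u \<noteq> v" "v \<noteq> w" "u \<noteq> w" using assms by auto
  then show "card {u, v, w} = 3" by simp
qed

text \<open>Components have at most two vertices. \<open>rep\<close> depends on the set
  \<open>comp u\<close> alone, so both ends of an edge choose the same representative, and exactly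
  one end is its own representative.\<close>

lemma bipartite_if_matching:
  assumes W: "W \<subseteq> pverts G"
    and deg: "\<And>u c c'. u \<in> W \<Longrightarrow> c \<in> W \<Longrightarrow> c' \<in> W \<Longrightarrow>
      (u, c) \<in> parcs G \<Longrightarrow> (u, c') \<in> parcs G \<Longrightarrow> c = c'"
  shows "bipartite_on G W"
proof -
  define comp where "comp u = insert u (nbrs G u \<inter> W)" for u
  define rep where "rep u = (SOME x. x \<in> comp u)" for u
  have rep: "rep u \<in> comp u" for u unfolding rep_def by (rule someI[of _ u]) (simp add: comp_def)
  have edge: "comp u = {u, c}" if "u \<in> W" "c \<in> W" "(u, c) \<in> parcs G" for u c
    unfolding comp_def nbrs_def using that deg[OF that(1) _ that(2) _ that(3)] by blast
  have rep_eq: "rep u = rep c" "rep u = u \<or> rep u = c" if "u \<in> W" "c \<in> W" "(u, c) \<in> parcs G" for u c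
  proof -
    have "comp u = comp c"
      using edge[OF that] edge[OF that(2) that(1) arc_sym[OF that(3)]] by (simp add: insert_commute)
    then show "rep u = rep c" by (simp add: rep_def)
    show "rep u = u \<or> rep u = c" using rep[of u] edge[OF that] by simp
  qed
  define A where "A = {u \<in> W. rep u = u}"
  have "(u, c) \<notin> parcs G" if "u \<in> A" "c \<in> A" for u c
    using rep_eq(1)[of u c] that by (auto simp: A_def)
  moreover have "(u, c) \<notin> parcs G" if "u \<in> W - A" "c \<in> W - A" for u c
    using rep_eq[of u c] that by (auto simp: A_def)
  ultimately have "stable G A" "stable G (W - A)"
    using W by (auto simp: stable_def A_def)
  moreover have "W = A \<union> (W - A)" by (auto simp: A_def)
  ultimately show ?thesis unfolding bipartite_on_def by blast
qed

text \<open>If some \<open>u\<close> has two neighbours in \<open>W\<close>, these neighbours form a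
  stable class by triangle-freeness, and the other class consists of \<open>u\<close> and at most
  one vertex not adjacent to it. Otherwise the edges form a matching.\<close>

lemma bipartite_if_triangle_free:
  assumes W: "W \<subseteq> pverts G" "card W \<le> 4"
    and free: "\<And>T. T \<subseteq> W \<Longrightarrow> clique G T \<Longrightarrow> card T \<noteq> 3"
  shows "bipartite_on G W"
proof (cases "\<exists>u c c'. u \<in> W \<and> c \<in> W \<and> c' \<in> W \<and> (u, c) \<in> parcs G \<and> (u, c') \<in> parcs G \<and> c \<noteq> c'")
  case False
  then show ?thesis using W by (intro bipartite_if_matching) blast+
next
  case True
  then obtain u c c' where u: "u \<in> W" "c \<in> W" "c' \<in> W" "(u, c) \<in> parcs G" "(u, c') \<in> parcs G" "c \<noteq> c'"
    by blast
  have fin: "finite W" using W pair_finite_verts finite_subset by blast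
  let ?A = "nbrs G u \<inter> W"
  have "stable G ?A"
    unfolding stable_def
  proof (intro conjI ballI notI)
    show "?A \<subseteq> pverts G" using W by auto
    fix x y assume xy: "x \<in> ?A" "y \<in> ?A" "(x, y) \<in> parcs G"
    then have "(u, x) \<in> parcs G" "(u, y) \<in> parcs G" by (auto simp: nbrs_def)
    then show False using clique_three[of u x y] free[of "{u, x, y}"] xy u(1) by auto
  qed
  moreover have "stable G (W - ?A)"
    unfolding stable_def
  proof (intro conjI ballI notI)
    show "W - ?A \<subseteq> pverts G" using W by auto
    have "{c, c'} \<subseteq> ?A" using u by (auto simp: nbrs_def)
    then have "2 \<le> card ?A" using card_mono[of ?A "{c, c'}"] fin u(6) by simp
    then have B: "card (W - ?A) \<le> 2" using card_Diff_subset[of ?A W] fin W(2) by simp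
    fix x y assume xy: "x \<in> W - ?A" "y \<in> W - ?A" "(x, y) \<in> parcs G"
    then have "x \<noteq> y" by auto
    have "u \<in> W - ?A" using u(1) by (simp add: nbrs_def)
    then have "{u, x, y} \<subseteq> W - ?A" using xy by blast
    then have "card {u, x, y} \<le> card (W - ?A)" using fin by (intro card_mono) auto
    then have "card {u, x, y} \<le> 2" using B by (rule order_trans)
    then have "u = x \<or> u = y" using \<open>x \<noteq> y\<close> by (auto simp: card_insert_if split: if_splits)
    then show False using xy arc_sym[OF xy(3)] by (auto simp: nbrs_def)
  qed
  ultimately show ?thesis
    unfolding bipartite_on_def by (intro exI[of _ ?A] exI[of _ "W - ?A"]) auto
qed

text \<open>The new vertex joins the class that avoids its neighbour \<open>c\<close>. The two
  classes may overlap, so \<open>c\<close> is removed from that class first.\<close>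

lemma bipartite_insert_pendant:
  assumes "bipartite_on G W" "w \<in> pverts G"
    and deg: "\<And>c c'. c \<in> W \<Longrightarrow> c' \<in> W \<Longrightarrow> (w, c) \<in> parcs G \<Longrightarrow> (w, c') \<in> parcs G \<Longrightarrow> c = c'"
  shows "bipartite_on G (insert w W)"
proof -
  from assms obtain A B where AB: "W = A \<union> B" "stable G A" "stable G B" by (auto simp: bipartite_on_def)
  have ext: "stable G (insert w S)" if "stable G S" "\<forall>c\<in>S. (w, c) \<notin> parcs G" for S
    using that assms(2) by (auto simp: stable_def dest: arc_sym)
  show ?thesis
  proof (cases "\<forall>c\<in>A. (w, c) \<notin> parcs G")
    case True
    then show ?thesis
      unfolding bipartite_on_def using AB ext[of A] by (intro exI[of _ "insert w A"] exI[of _ B]) auto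
  next
    case False
    then obtain c where c: "c \<in> A" "(w, c) \<in> parcs G" by blast
    then have "\<forall>c'\<in>B - {c}. (w, c') \<notin> parcs G" using deg[of c] AB(1) by blast
    moreover have "stable G (B - {c})" using AB(3) by (auto simp: stable_def)
    ultimately show ?thesis
      unfolding bipartite_on_def using AB ext[of "B - {c}"] c(1)
      by (intro exI[of _ A] exI[of _ "insert w (B - {c})"]) auto
  qed
qed

text \<open>Removing \<open>v\<close> maps the triangles at \<open>v\<close> injectively to pairs of
  neighbours; equality means that every pair of neighbours is adjacent.\<close>

lemma card_triangles_at_le: "card (triangles_at G v) \<le> card (nbrs G v) choose 2"
  and nbrs_clique: "card (triangles_at G v) = card (nbrs G v) choose 2 \<Longrightarrow> clique G (nbrs G v)"
proof -
  let ?P = "{B. B \<subseteq> nbrs G v \<and> card B = 2}"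
  let ?f = "\<lambda>T. T - {v}"
  have finP: "finite ?P" by (rule finite_subset[of _ "Pow (nbrs G v)"]) auto
  have inj: "inj_on ?f (triangles_at G v)"
    by (auto simp: inj_on_def triangles_at_def)
  have sub: "?f ` triangles_at G v \<subseteq> ?P"
    by (auto simp: triangles_at_def clique_def nbrs_def)
  have cardP: "card ?P = card (nbrs G v) choose 2" by (rule n_subsets) simp
  show "card (triangles_at G v) \<le> card (nbrs G v) choose 2"
    using card_inj_on_le[OF inj sub finP] cardP by simp
  assume "card (triangles_at G v) = card (nbrs G v) choose 2"
  then have eq: "?f ` triangles_at G v = ?P"
    using card_subset_eq[OF finP sub] card_image[OF inj] cardP by simp
  show "clique G (nbrs G v)"
    unfolding clique_def
  proof (intro conjI ballI impI nbrs_subset)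
    fix a b assume "a \<in> nbrs G v" "b \<in> nbrs G v" "a \<noteq> b"
    then have "{a, b} \<in> ?P" by simp
    then obtain T where "T \<in> triangles_at G v" "{a, b} = T - {v}" unfolding eq [symmetric] by blast
    then have "clique G T" "a \<in> T" "b \<in> T" by (auto simp: triangles_at_def)
    then show "(a, b) \<in> parcs G" using \<open>a \<noteq> b\<close> by (auto simp: clique_def)
  qed
qed

text \<open>In a vertex-transitive graph all summands agree, so this becomes a divisibility
  condition by 3.\<close>

lemma sum_card_triangles_at:
  "(\<Sum>v\<in>pverts G. card (triangles_at G v)) = 3 * card {T. clique G T \<and> card T = 3}"
proof -
  let ?T = "{T. clique G T \<and> card T = 3}"
  have "?T \<subseteq> Pow (pverts G)" by (auto simp: clique_def)
  then have "finite ?T" by (rule finite_subset) (simp add: pair_finite_verts)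
  moreover have "\<forall>T\<in>?T. card {v \<in> pverts G. v \<in> T} = 3"
  proof
    fix T assume T: "T \<in> ?T"
    then have "{v \<in> pverts G. v \<in> T} = T" by (auto simp: clique_def)
    then show "card {v \<in> pverts G. v \<in> T} = 3" using T by simp
  qed
  ultimately have "(\<Sum>v\<in>pverts G. card {T \<in> ?T. v \<in> T}) = 3 * card ?T"
    using pair_finite_verts by (intro sum_multicount) auto
  then show ?thesis by (simp add: triangles_at_def conj_assoc)
qed

lemma vertex_transitive_invariants:
  assumes "vertex_transitive G" "u \<in> pverts G" "v \<in> pverts G"
  shows "card (non_nbrs G u) = card (non_nbrs G v)" "card (nbrs G u) = card (nbrs G v)"
    "card (triangles_at G u) = card (triangles_at G v)"
    "clique G (non_nbrs G u) \<Longrightarrow> clique G (non_nbrs G v)"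
proof -
  obtain h where h: "arc_iso h G G" "h u = v"
    using assms vertex_transitive_iff[OF pair_wf_digraph_axioms] by blast
  have inj: "inj_on h (pverts G)" using h by (simp add: arc_iso_def bij_betw_def)
  have non: "non_nbrs G v = h ` non_nbrs G u" using arc_iso_non_nbrs[OF h(1) assms(2)] h(2) by simp
  moreover have "inj_on h (non_nbrs G u)" using inj by (rule inj_on_subset) (auto simp: non_nbrs_def)
  ultimately show *: "card (non_nbrs G u) = card (non_nbrs G v)" by (simp add: card_image)
  show "card (nbrs G u) = card (nbrs G v)" 
    using card_verts[OF assms(2)] card_verts[OF assms(3)] * by linarith
  show "clique G (non_nbrs G u) \<Longrightarrow> clique G (non_nbrs G v)"
    unfolding non by (rule arc_iso_clique[OF h(1)])
  \<comment> \<open>Stated for arbitrary \<open>x\<close> and \<open>y\<close>, so that exchanging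
    them yields equality.\<close>
  have le: "card (triangles_at G x) \<le> card (triangles_at G y)" if xy: "x \<in> pverts G" "y \<in> pverts G" for x y
  proof -
    obtain h where h: "arc_iso h G G" "h x = y"
      using assms(1) xy vertex_transitive_iff[OF pair_wf_digraph_axioms] by blast
    have inj: "inj_on h (pverts G)" using h by (simp add: arc_iso_def bij_betw_def)
    have "triangles_at G z \<subseteq> Pow (pverts G)" for z by (auto simp: triangles_at_def clique_def)
    then have sub: "triangles_at G z \<subseteq> Pow (pverts G)" "finite (triangles_at G z)" for z
      using pair_finite_verts finite_subset[of "triangles_at G z" "Pow (pverts G)"] by simp_all
    have "inj_on ((`) h) (triangles_at G x)"
      using inj_on_image_Pow[OF inj] sub(1) by (rule inj_on_subset)
    moreover have "(`) h ` triangles_at G x \<subseteq> triangles_at G y"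
    proof (rule image_subsetI)
      fix T assume T: "T \<in> triangles_at G x"
      then have "inj_on h T" using sub(1)[of x] inj inj_on_subset[of h "pverts G" T] by auto
      then show "h ` T \<in> triangles_at G y"
        using T arc_iso_clique[OF h(1)] h(2) by (auto simp: triangles_at_def card_image)
    qed
    ultimately show ?thesis by (rule card_inj_on_le) (rule sub(2))
  qed
  show "card (triangles_at G u) = card (triangles_at G v)"
    using le assms(2,3) by (simp add: le_antisym)
qed

text \<open>Packages the structural hypotheses of
  \<open>LS_plus_graph_1_eq_STAB_if_two_cliques\<close>. The matching may be empty, which covers
  disjoint unions.\<close>

definition two_cliques :: "'a set \<Rightarrow> 'a set \<Rightarrow> bool" where
  "two_cliques U W \<longleftrightarrow> pverts G = U \<union> W \<and> U \<inter> W = {} \<and> U \<noteq> {} \<and> W \<noteq> {} \<and> clique G U \<and> clique G W \<and>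
    (\<forall>u\<in>U. \<forall>w\<in>W. \<forall>w'\<in>W. (u, w) \<in> parcs G \<longrightarrow> (u, w') \<in> parcs G \<longrightarrow> w = w') \<and>
    (\<forall>u\<in>U. \<forall>u'\<in>U. \<forall>w\<in>W. (u, w) \<in> parcs G \<longrightarrow> (u', w) \<in> parcs G \<longrightarrow> u = u')"

text \<open>Clique neighbourhoods make adjacency transitive, so closed neighbourhoods are components
  of \<open>d + 1\<close> vertices. The one of a non-neighbour of \<open>v\<close> fits into
  \<open>non_nbrs G v\<close> and fills it.\<close>

lemma two_cliques_if_nbrs_cliques:
  assumes N: "\<And>v. v \<in> pverts G \<Longrightarrow> clique G (nbrs G v)" "\<And>v. v \<in> pverts G \<Longrightarrow> card (nbrs G v) = d"
    and v: "v \<in> pverts G" "non_nbrs G v \<noteq> {}" "card (non_nbrs G v) \<le> d + 1"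
  shows "two_cliques (insert v (nbrs G v)) (non_nbrs G v)"
proof -
  have closed: "(v, y) \<in> parcs G" if "(v, x) \<in> parcs G" "(x, y) \<in> parcs G" "y \<noteq> v" for v x y
  proof -
    have "clique G (nbrs G x)" using N(1) that in_arcsD2 by blast
    moreover have "v \<in> nbrs G x" "y \<in> nbrs G x" using that arc_sym by (auto simp: nbrs_def)
    ultimately show ?thesis using that(3) by (auto simp: clique_def)
  qed
  have clique: "clique G (insert v (nbrs G v))" if "v \<in> pverts G" for v
    using N(1)[OF that] that by (auto simp: clique_def nbrs_def dest: arc_sym)
  have no_cross: "(u, w) \<notin> parcs G" if "u \<in> insert v (nbrs G v)" "w \<in> non_nbrs G v" for u w
    using that closed[of v u w] by (auto simp: nbrs_def non_nbrs_def)
  obtain w where w: "w \<in> non_nbrs G v" using v(2) by blast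
  then have wV: "w \<in> pverts G" by (simp add: non_nbrs_def)
  have "insert w (nbrs G w) \<subseteq> non_nbrs G v"
  proof
    fix x assume x: "x \<in> insert w (nbrs G w)"
    then have "x \<in> pverts G" using wV nbrs_subset by blast
    moreover have "x \<notin> insert v (nbrs G v)"
      using x no_cross[of x w] w arc_sym[of w x] by (auto simp: nbrs_def non_nbrs_def)
    ultimately show "x \<in> non_nbrs G v" by (auto simp: nbrs_def non_nbrs_def)
  qed
  moreover have "card (insert w (nbrs G w)) = d + 1"
    using N(2)[OF wV] by (subst card_insert_disjoint) (simp_all, simp add: nbrs_def)
  ultimately have "insert w (nbrs G w) = non_nbrs G v"
    using v(3) card_mono[of "non_nbrs G v" "insert w (nbrs G w)"] by (intro card_subset_eq) auto
  then have "clique G (non_nbrs G v)" using clique[OF wV] by simp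
  moreover have "pverts G = insert v (nbrs G v) \<union> non_nbrs G v"
    using v(1) nbrs_subset by (auto simp: nbrs_def non_nbrs_def)
  moreover have "insert v (nbrs G v) \<inter> non_nbrs G v = {}" by (auto simp: nbrs_def non_nbrs_def)
  ultimately show ?thesis
    unfolding two_cliques_def using clique[OF v(1)] v(2) no_cross by simp
qed

lemma arc_iff_non_nbrs:
  assumes "u \<in> pverts G" "w \<in> pverts G"
  shows "(u, w) \<in> parcs G \<longleftrightarrow> w \<notin> insert u (non_nbrs G u)"
  using assms by (auto simp: non_nbrs_def)

text \<open>All three non-neighbours of a vertex lie in the opposite clique of four, which leaves
  exactly one cross edge.\<close>

lemma two_cliques_if_card_4:
  assumes UW: "pverts G = U \<union> W" "U \<inter> W = {}" "card U = 4" "card W = 4" "clique G U" "clique G W"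
    and deg: "\<And>u. u \<in> pverts G \<Longrightarrow> card (non_nbrs G u) = 3"
  shows "two_cliques U W"
proof -
  have unique: "w = w'"
    if "pverts G = S \<union> T" "clique G S" "card T = 4" "u \<in> S" "w \<in> T" "w' \<in> T"
      "(u, w) \<in> parcs G" "(u, w') \<in> parcs G" for S T u w w'
  proof -
    have sub: "non_nbrs G u \<subseteq> T" using that by (auto simp: non_nbrs_def clique_def)
    have "card (T - non_nbrs G u) = 1"
      using deg[of u] that card_Diff_subset[OF _ sub] by simp
    moreover have "w \<in> T - non_nbrs G u" "w' \<in> T - non_nbrs G u" using that by (auto simp: non_nbrs_def)
    ultimately show ?thesis by (metis card_1_singletonE singletonD)
  qed
  have "pverts G = W \<union> U" using UW(1) by blast
  then show ?thesis
    unfolding two_cliques_def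
    using UW unique[OF UW(1,5,4)] unique[OF _ UW(6,3)] arc_sym by (metis card.empty zero_neq_numeral)
qed

text \<open>
  The complement of the squared 8-cycle is the Wagner graph, that is, the cycle \<open>v x q p w s r y\<close>
  with its four long diagonals.
\<close>

lemma arc_iso_circulant_8_if_labelled:
  assumes V: "pverts G = {v, x, y, w, p, q, r, s}" "distinct [v, x, y, w, p, q, r, s]"
    and H: "non_nbrs G v = {x, y, w}" "non_nbrs G x = {v, q, s}" "non_nbrs G y = {v, p, r}"
      "non_nbrs G w = {v, p, s}" "non_nbrs G p = {q, y, w}" "non_nbrs G q = {p, r, x}"
      "non_nbrs G r = {q, s, y}" "non_nbrs G s = {r, x, w}"
  shows "\<exists>f. arc_iso f G (circulant 8 {1, 2})"
proof -
  \<comment> \<open>The labels advance by 3 modulo 8 along the cycle \<open>v x q p w s r y\<close>,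
    and the long diagonals become difference 4: the non-adjacent differences of the squared
    8-cycle.\<close>
  define f :: "'a \<Rightarrow> nat" where "f u = (if u = v then 1 else if u = x then 4 else if u = y then 6
    else if u = w then 5 else if u = p then 2 else if u = q then 7 else if u = r then 3 else 8)" for u
  have f: "f v = 1" "f x = 4" "f y = 6" "f w = 5" "f p = 2" "f q = 7" "f r = 3" "f s = 8"
    using V(2) by (auto simp: f_def)
  have "{1..8::nat} = {1, 2, 3, 4, 5, 6, 7, 8}" by auto
  then have img: "f ` pverts G = {1..8}" unfolding V(1) by (auto simp: f)
  moreover have "inj_on f (pverts G)"
    by (rule eq_card_imp_inj_on) (use V img in \<open>auto simp: pair_finite_verts\<close>)
  ultimately have "bij_betw f (pverts G) {1..8}" by (simp add: bij_betw_def)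
  moreover have "(i, j) \<in> parcs G \<longleftrightarrow> (f i, f j) \<in> parcs (circulant 8 {1, 2})"
    if "i \<in> pverts G" "j \<in> pverts G" for i j
  proof -
    \<comment> \<open>The reversed list supplies the disequalities in the other orientation for
      simplification.\<close>
    have "distinct [s, r, q, p, w, y, x, v]" using V(2) by auto
    then have all: "\<forall>i\<in>{v, x, y, w, p, q, r, s}. \<forall>j\<in>{v, x, y, w, p, q, r, s}.
        j \<notin> insert i (non_nbrs G i) \<longleftrightarrow> (int (f j) - int (f i)) mod 8 \<in> {1, 2, 6, 7}"
      using V(2) by (simp add: H f)
    have fij: "f i \<in> {1..8}" "f j \<in> {1..8}" using img that by blast+
    have "j \<notin> insert i (non_nbrs G i) \<longleftrightarrow> (int (f j) - int (f i)) mod 8 \<in> {1, 2, 6, 7}"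
      using that unfolding V(1) by (rule bspec[OF bspec[OF all]])
    then show ?thesis by (simp only: arc_iff_non_nbrs[OF that] circulant_8_arc[OF fij])
  qed
  ultimately have "arc_iso f G (circulant 8 {1, 2})" by (simp add: arc_iso_def circulant_def)
  then show ?thesis by blast
qed

section \<open>Graphs whose complement is cubic and triangle-free\<close>

context
  assumes card_non_nbrs: "\<And>u. u \<in> pverts G \<Longrightarrow> card (non_nbrs G u) = 3"
    and clique_non_nbrs: "\<And>u. u \<in> pverts G \<Longrightarrow> clique G (non_nbrs G u)"
begin

lemma non_nbrs_triangle_free:
  assumes "u \<in> pverts G" "x \<in> non_nbrs G u" "y \<in> non_nbrs G u"
  shows "y \<notin> non_nbrs G x"
  using clique_non_nbrs[OF assms(1)] assms by (auto simp: clique_def non_nbrs_def)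

lemma non_nbrs_eq:
  assumes "u \<in> pverts G" "distinct [i, j, k]" "i \<in> non_nbrs G u" "j \<in> non_nbrs G u" "k \<in> non_nbrs G u"
  shows "non_nbrs G u = {i, j, k}"
proof -
  have "{i, j, k} = non_nbrs G u"
    using assms card_non_nbrs[OF assms(1)] by (intro card_subset_eq) auto
  then show ?thesis ..
qed

text \<open>In the complement, the vertices outside \<open>v\<close> and its neighbours induce the
  path \<open>p q r s\<close>. The inner vertices \<open>q\<close> and \<open>r\<close> have one
  neighbour each among \<open>a, b, c\<close>, say \<open>x\<close> and \<open>y\<close>, distinct
  as there are no triangles. Then \<open>p\<close> must avoid \<open>x\<close> and \<open>s\<close>
  must avoid \<open>y\<close>, which forces all remaining edges.\<close>

lemma arc_iso_circulant_8_if_path: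
  assumes V: "pverts G = {v, a, b, c, p, q, r, s}" "distinct [v, a, b, c, p, q, r, s]"
    and H: "non_nbrs G v = {a, b, c}" "p \<in> non_nbrs G q" "r \<in> non_nbrs G q" "s \<in> non_nbrs G r"
      "s \<notin> non_nbrs G q" "s \<notin> non_nbrs G p"
  shows "\<exists>f. arc_iso f G (circulant 8 {1, 2})"
proof -
  have in_V: "v \<in> pverts G" "a \<in> pverts G" "b \<in> pverts G" "c \<in> pverts G"
    "p \<in> pverts G" "q \<in> pverts G" "r \<in> pverts G" "s \<in> pverts G" using V(1) by auto
  have irrefl: "u \<notin> non_nbrs G u" for u by (simp add: non_nbrs_def)
  have sub: "non_nbrs G u \<subseteq> {v, a, b, c, p, q, r, s}" for u unfolding V(1) [symmetric] by (auto simp: non_nbrs_def)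
  have third: "\<exists>z. z \<in> non_nbrs G u \<and> z \<noteq> i \<and> z \<noteq> j" if "u \<in> pverts G" for u i j
  proof (rule ccontr)
    assume "\<nexists>z. z \<in> non_nbrs G u \<and> z \<noteq> i \<and> z \<noteq> j"
    then have "non_nbrs G u \<subseteq> {i, j}" by blast
    then have "card (non_nbrs G u) \<le> card {i, j}" by (intro card_mono) auto
    also have "\<dots> \<le> 2" by (simp add: card_insert_if)
    finally show False using card_non_nbrs[OF that] by simp
  qed
  have not_v: "v \<notin> non_nbrs G u" if "u \<in> {p, q, r, s}" for u
  proof
    assume "v \<in> non_nbrs G u"
    then have "u \<in> non_nbrs G v" using that V(1) non_nbrs_sym[of v u] by auto
    then show False using that V(2) unfolding H(1) by auto
  qed
  have qp: "q \<in> non_nbrs G p" and qr: "q \<in> non_nbrs G r" and rs: "r \<in> non_nbrs G s"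
    using H(2,3,4) in_V non_nbrs_sym[of p q] non_nbrs_sym[of r q] non_nbrs_sym[of s r] by simp_all
  have pr: "p \<notin> non_nbrs G r" "r \<notin> non_nbrs G p"
    using non_nbrs_triangle_free[OF in_V(6) H(3,2)] non_nbrs_triangle_free[OF in_V(6) H(2,3)] by simp_all
  have sym: "k \<in> non_nbrs G u" if "u \<in> non_nbrs G k" "k \<in> pverts G" for u k
    using that by (rule non_nbrs_sym)
  obtain x where x: "x \<in> non_nbrs G q" "x \<noteq> p" "x \<noteq> r" using third[OF in_V(6)] by blast
  have "x \<noteq> q" "x \<noteq> v" "x \<noteq> s" using x(1) irrefl not_v[of q] H(5) by auto
  then have x_abc: "x \<in> {a, b, c}" using x sub[of q] by blast
  obtain y where y: "y \<in> non_nbrs G r" "y \<noteq> q" "y \<noteq> s" using third[OF in_V(7)] by blast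
  have "y \<noteq> r" "y \<noteq> v" "y \<noteq> p" using y(1) irrefl not_v[of r] pr by auto
  then have y_abc: "y \<in> {a, b, c}" using y sub[of r] by blast
  have "x \<notin> non_nbrs G r" using non_nbrs_triangle_free[OF in_V(6) H(3) x(1)] .
  then have "x \<noteq> y" using y(1) by auto
  then obtain w where w: "{a, b, c} = {x, y, w}" "w \<noteq> x" "w \<noteq> y" "w \<in> {a, b, c}"
    using x_abc y_abc V(2) by auto
  have V': "pverts G = {v, x, y, w, p, q, r, s}"
    unfolding V(1) using w(1) by auto
  \<comment> \<open>Distinctness of the relabelled list follows from equality of the underlying sets
    and of the lengths.\<close>
  have "set [v, x, y, w, p, q, r, s] = set [v, a, b, c, p, q, r, s]"
    using V(1) V' by simp
  then have "card (set [v, x, y, w, p, q, r, s]) = length [v, x, y, w, p, q, r, s]"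
    using distinct_card[OF V(2)] by (simp only: list.size)
  then have dist: "distinct [v, x, y, w, p, q, r, s]" by (rule card_distinct)
  have xyw: "x \<in> pverts G" "y \<in> pverts G" "w \<in> pverts G" unfolding V' by auto
  have Hv: "non_nbrs G v = {x, y, w}" using H(1) w(1) by simp
  have sub': "non_nbrs G u \<subseteq> {v, x, y, w, p, q, r, s}" for u unfolding V' [symmetric] by (auto simp: non_nbrs_def)
  have Hq: "non_nbrs G q = {p, r, x}" 
    by (rule non_nbrs_eq[OF in_V(6) _ H(2,3) x(1)]) (use dist in auto)
  have Hr: "non_nbrs G r = {q, s, y}" 
    by (rule non_nbrs_eq[OF in_V(7) _ qr H(4) y(1)]) (use dist in auto)
  have "x \<notin> non_nbrs G p" using non_nbrs_triangle_free[OF in_V(6) H(2) x(1)] .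
  then have "non_nbrs G p \<subseteq> {q, y, w}"
    using sub'[of p] not_v[of p] irrefl[of p] pr H(6) by auto
  then have Hp: "non_nbrs G p = {q, y, w}"
    using card_non_nbrs[OF in_V(5)] dist by (intro card_subset_eq) auto
  have "y \<notin> non_nbrs G s" using non_nbrs_triangle_free[OF in_V(7) H(4) y(1)] .
  moreover have "q \<notin> non_nbrs G s" "p \<notin> non_nbrs G s"
    using H(5,6) sym[of q s] sym[of p s] in_V by auto
  ultimately have "non_nbrs G s \<subseteq> {r, x, w}"
    using sub'[of s] not_v[of s] irrefl[of s] by auto
  then have Hs: "non_nbrs G s = {r, x, w}"
    using card_non_nbrs[OF in_V(8)] dist by (intro card_subset_eq) auto
  have Hx: "non_nbrs G x = {v, q, s}"
    using dist xyw in_V sym[of x v] sym[of x q] sym[of x s]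
    by (intro non_nbrs_eq) (simp_all add: Hv Hq Hs)
  have Hy: "non_nbrs G y = {v, p, r}"
    using dist xyw in_V sym[of y v] sym[of y p] sym[of y r]
    by (intro non_nbrs_eq) (simp_all add: Hv Hp Hr)
  have Hw: "non_nbrs G w = {v, p, s}"
    using dist xyw in_V sym[of w v] sym[of w p] sym[of w s]
    by (intro non_nbrs_eq) (simp_all add: Hv Hp Hs)
  show ?thesis by (rule arc_iso_circulant_8_if_labelled[OF V' dist Hv Hx Hy Hw Hp Hq Hr Hs])
qed

text \<open>In the complement, let \<open>M\<close> be the four vertices other than \<open>v\<close>
  and its neighbours. Six edges join \<open>a, b, c\<close> to \<open>M\<close>, so three of the
  edges lie inside \<open>M\<close>; without a triangle they form a star or a path. The star makes
  the complement bipartite, hence two cliques in \<open>G\<close>; the path gives the Wagner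
  graph.\<close>

lemma two_cliques_or_circulant_8:
  assumes "card (pverts G) = 8"
  shows "(\<exists>U W. two_cliques U W) \<or> (\<exists>f. arc_iso f G (circulant 8 {1, 2}))"
proof -
  let ?H = "non_nbrs G"
  have "pverts G \<noteq> {}" using assms by auto
  then obtain v where v: "v \<in> pverts G" by blast
  obtain a b c where H_v: "?H v = {a, b, c}" and abc: "a \<noteq> b" "b \<noteq> c" "a \<noteq> c"
    using card_non_nbrs[OF v] unfolding card_3_iff by blast
  have irrefl: "u \<notin> ?H u" for u by (simp add: non_nbrs_def)
  have sub: "?H u \<subseteq> pverts G" for u by (auto simp: non_nbrs_def)
  note sym = non_nbrs_sym
  have sym_iff: "i \<in> ?H j \<longleftrightarrow> j \<in> ?H i" if "i \<in> pverts G" "j \<in> pverts G" for i j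
    using sym[of i j] sym[of j i] that by blast
  have abcV: "{a, b, c} \<subseteq> pverts G" "v \<notin> {a, b, c}" using sub[of v] irrefl[of v] unfolding H_v by auto
  define M where "M = pverts G - {v, a, b, c}"
  have finM: "finite M" and MV: "M \<subseteq> pverts G" by (auto simp: M_def pair_finite_verts)
  have V_M: "pverts G = {v, a, b, c} \<union> M" using v abcV by (auto simp: M_def)
  have "card {v, a, b, c} = 4" using abc abcV(2) by auto
  then have "card M = 4"
    unfolding M_def using assms v abcV by (subst card_Diff_subset) auto
  have split: "card (?H m \<inter> {a, b, c}) + card (?H m \<inter> M) = 3" if m: "m \<in> M" for m
  proof -
    have "v \<notin> ?H m" using m sym_iff[of v m] v MV H_v by (auto simp: M_def)
    then have "?H m = (?H m \<inter> {a, b, c}) \<union> (?H m \<inter> M)" using sub[of m] unfolding V_M by blast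
    moreover have "card ((?H m \<inter> {a, b, c}) \<union> (?H m \<inter> M)) = card (?H m \<inter> {a, b, c}) + card (?H m \<inter> M)"
      by (rule card_Un_disjoint) (auto simp: M_def)
    ultimately show ?thesis using card_non_nbrs[of m] m MV by auto
  qed
  have two: "\<forall>x\<in>{a, b, c}. card {m \<in> M. x \<in> ?H m} = 2"
  proof
    fix x assume x: "x \<in> {a, b, c}"
    then have xV: "x \<in> pverts G" and xv: "x \<in> ?H v" using abcV H_v by auto
    have "?H x \<inter> {a, b, c} = {}" using non_nbrs_triangle_free[OF v xv] H_v by auto
    then have "?H x \<subseteq> insert v M" using sub[of x] unfolding V_M by blast
    moreover have "x \<in> ?H m \<longleftrightarrow> m \<in> ?H x" if "m \<in> M" for m
      using sym_iff[of x m] xV MV that by blast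
    moreover have "v \<notin> M" by (simp add: M_def)
    ultimately have "{m \<in> M. x \<in> ?H m} = ?H x - {v}" by blast
    moreover have "v \<in> ?H x" using sym[OF xv v] .
    ultimately show "card {m \<in> M. x \<in> ?H m} = 2" using card_non_nbrs[OF xV] by simp
  qed
  \<comment> \<open>Double counting of the complement edges between \<open>{a, b, c}\<close> and
    \<open>M\<close>; the degree sum 12 of \<open>M\<close> then leaves 6 inside
    \<open>M\<close>.\<close>
  have "(\<Sum>m\<in>M. card {x \<in> {a, b, c}. x \<in> ?H m}) = 2 * card {a, b, c}"
    by (rule sum_multicount[OF finM _ two]) simp
  moreover have "{x \<in> {a, b, c}. x \<in> ?H m} = ?H m \<inter> {a, b, c}" for m by blast
  ultimately have "(\<Sum>m\<in>M. card (?H m \<inter> {a, b, c})) = 6" using abc by simp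
  moreover have "(\<Sum>m\<in>M. card (?H m \<inter> {a, b, c}) + card (?H m \<inter> M)) = (\<Sum>m\<in>M. 3)"
    by (intro sum.cong refl split)
  ultimately have six: "(\<Sum>m\<in>M. card (?H m \<inter> M)) = 6" 
    using \<open>card M = 4\<close> by (simp add: sum.distrib)
  have "\<exists>q\<in>M. 2 \<le> card (?H q \<inter> M)"
  proof (rule ccontr)
    assume "\<not> ?thesis"
    then have "card (?H m \<inter> M) \<le> 1" if "m \<in> M" for m using that by force
    then have "(\<Sum>m\<in>M. card (?H m \<inter> M)) \<le> (\<Sum>m\<in>M. 1)" by (rule sum_mono)
    then show False using six \<open>card M = 4\<close> by simp
  qed
  then obtain q where q: "q \<in> M" "2 \<le> card (?H q \<inter> M)" by blast
  then obtain S where "S \<subseteq> ?H q \<inter> M" "card S = 2" by (meson obtain_subset_with_card_n)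
  then obtain p r where pr: "p \<in> ?H q" "r \<in> ?H q" "p \<in> M" "r \<in> M" "p \<noteq> r"
    unfolding card_2_iff by auto
  have pq: "p \<noteq> q" "r \<noteq> q" using pr irrefl by auto
  have "card (M - {p, q, r}) = 1"
    using \<open>card M = 4\<close> pr pq q(1) by (subst card_Diff_subset) auto
  then obtain s where s: "M - {p, q, r} = {s}" by (rule card_1_singletonE)
  then have M: "M = {p, q, r, s}" and ps: "s \<noteq> p" "s \<noteq> q" "s \<noteq> r" using pr q by auto
  have V: "pverts G = {v, a, b, c, p, q, r, s}" unfolding V_M M by auto
  then have set: "set [v, a, b, c, p, q, r, s] = pverts G" by simp
  have dist: "distinct [v, a, b, c, p, q, r, s]"
    by (rule card_distinct, unfold set) (simp add: assms)
  have in_V: "a \<in> pverts G" "b \<in> pverts G" "c \<in> pverts G"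
    "p \<in> pverts G" "q \<in> pverts G" "r \<in> pverts G" "s \<in> pverts G" using V by auto
  have pr_free: "p \<notin> ?H r" "r \<notin> ?H p" using non_nbrs_triangle_free[OF in_V(5) pr(2,1)] non_nbrs_triangle_free[OF in_V(5) pr(1,2)] by simp_all
  have q_in: "q \<in> ?H p" "q \<in> ?H r" using sym[OF pr(1)] sym[OF pr(2)] in_V by simp_all
  show ?thesis
  proof (cases "s \<in> ?H q")
    case True
    have sp: "s \<notin> ?H p" "s \<notin> ?H r" "p \<notin> ?H s" "r \<notin> ?H s"
      using non_nbrs_triangle_free[OF in_V(5) pr(1) True] non_nbrs_triangle_free[OF in_V(5) pr(2) True]
        non_nbrs_triangle_free[OF in_V(5) True pr(1)] non_nbrs_triangle_free[OF in_V(5) True pr(2)]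
      by simp_all
    have H_q: "?H q = {p, r, s}" 
      by (rule non_nbrs_eq[OF in_V(5) _ pr(1,2) True]) (use pr(5) ps in auto)
    have abc_free: "i \<notin> ?H j" if "i \<in> {a, b, c}" "j \<in> {a, b, c}" for i j
      using non_nbrs_triangle_free[OF v, of j i] that H_v by auto
    have qabc: "i \<notin> ?H q" "q \<notin> ?H i" if "i \<in> {a, b, c}" for i
      using that H_q dist sym_iff[of i q] in_V by auto
    have vM: "i \<notin> ?H v" "v \<notin> ?H i" if "i \<in> {p, r, s}" for i
      using that H_v dist sym_iff[of i v] in_V v by auto
    have "clique G {v, p, r, s}"
      unfolding clique_def using in_V v sp pr_free vM by (auto simp: arc_iff_non_nbrs)
    moreover have "clique G {q, a, b, c}"
      unfolding clique_def using in_V abc_free qabc by (auto simp: arc_iff_non_nbrs)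
    moreover have "pverts G = {v, p, r, s} \<union> {q, a, b, c}" "{v, p, r, s} \<inter> {q, a, b, c} = {}"
      "card {v, p, r, s} = 4" "card {q, a, b, c} = 4"
      using V dist by auto
    ultimately have "two_cliques {v, p, r, s} {q, a, b, c}"
      using card_non_nbrs by (intro two_cliques_if_card_4) auto
    then show ?thesis by blast
  next
    case False
    have qs: "q \<notin> ?H s" using False sym_iff[of q s] in_V by blast
    have sums: "card (?H p \<inter> M) + card (?H q \<inter> M) + card (?H r \<inter> M) + card (?H s \<inter> M) = 6"
      using six dist unfolding M by simp
    have sym_s: "p \<in> ?H s \<longleftrightarrow> s \<in> ?H p" "r \<in> ?H s \<longleftrightarrow> s \<in> ?H r"
      using sym_iff[of p s] sym_iff[of r s] in_V by simp_all
    have "?H q \<inter> M = {p, r}" unfolding M using pr False irrefl by auto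
    then have lq: "card (?H q \<inter> M) = 2" using pr by simp
    have "?H p \<inter> M = (if s \<in> ?H p then {q, s} else {q})"
      unfolding M using q_in pr_free irrefl by auto
    then have lp: "card (?H p \<inter> M) = (if s \<in> ?H p then 2 else 1)" using ps by simp
    have "?H r \<inter> M = (if s \<in> ?H r then {q, s} else {q})"
      unfolding M using q_in pr_free irrefl by auto
    then have lr: "card (?H r \<inter> M) = (if s \<in> ?H r then 2 else 1)" using ps by simp
    have "?H s \<inter> M = (if s \<in> ?H p then {p} else {}) \<union> (if s \<in> ?H r then {r} else {})"
      unfolding M using sym_s qs irrefl by auto
    then have ls: "card (?H s \<inter> M) = (if s \<in> ?H p then 1 else 0) + (if s \<in> ?H r then 1 else 0)"
      using pr by simp
    \<comment> \<open>The edges \<open>p q\<close> and \<open>q r\<close> account for 4 of the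
      degree sum 6, so exactly one edge at \<open>s\<close> remains.\<close>
    have "(s \<in> ?H r \<and> s \<notin> ?H p) \<or> (s \<in> ?H p \<and> s \<notin> ?H r)"
      using sums unfolding lq lp lr ls by (simp split: if_splits)
    then show ?thesis
    proof
      assume s: "s \<in> ?H r \<and> s \<notin> ?H p"
      show ?thesis
        using arc_iso_circulant_8_if_path[OF V dist H_v pr(1,2)] s False by blast
    next
      assume s: "s \<in> ?H p \<and> s \<notin> ?H r"
      have "pverts G = {v, a, b, c, r, q, p, s}" "distinct [v, a, b, c, r, q, p, s]"
        using V dist by auto
      from arc_iso_circulant_8_if_path[OF this H_v pr(2,1)] show ?thesis using s False by blast
    qed
  qed
qed

end

text \<open>A triangle exists, so \<open>1 <= t <= d choose 2\<close>, and 3 divides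
  \<open>n t\<close>. For \<open>d = 2\<close> and \<open>d = 3\<close> this forces
  \<open>t = d choose 2\<close>, so neighbourhoods are cliques; for \<open>d = 4\<close> the three
  non-neighbours form a triangle and the complement is classified.\<close>

lemma small_vertex_transitive_cases:
  assumes vt: "vertex_transitive G" and n: "card (pverts G) \<le> 8"
    and v: "v \<in> pverts G" "\<not> bipartite_on G (non_nbrs G v)"
  shows "(\<exists>U W. two_cliques U W) \<or> (\<exists>f. arc_iso f G (circulant 8 {1, 2}))"
proof -
  let ?W = "non_nbrs G v"
  define d where "d = card (nbrs G v)"
  have deg: "card (nbrs G u) = d" if "u \<in> pverts G" for u
    unfolding d_def using vertex_transitive_invariants(2)[OF vt that v(1)] .
  have WV: "?W \<subseteq> pverts G" by (auto simp: non_nbrs_def)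
  have card_V: "card (pverts G) = 1 + d + card ?W" unfolding d_def by (rule card_verts[OF v(1)])
  have d2: "2 \<le> d"
  proof (rule ccontr)
    assume "\<not> 2 \<le> d"
    have "c = c'" if "(u, c) \<in> parcs G" "(u, c') \<in> parcs G" for u c c'
    proof (rule ccontr)
      assume "c \<noteq> c'"
      moreover have "{c, c'} \<subseteq> nbrs G u" using that by (auto simp: nbrs_def)
      then have "card {c, c'} \<le> card (nbrs G u)" by (intro card_mono) auto
      ultimately show False using deg[of u] in_arcsD1[OF that(1)] \<open>\<not> 2 \<le> d\<close> by simp
    qed
    then show False using v(2) bipartite_if_matching[OF WV] by blast
  qed
  have triangle: "\<exists>T. clique G T \<and> card T = 3"
  proof (rule ccontr)
    assume free: "\<nexists>T. clique G T \<and> card T = 3"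
    then have bip: "bipartite_on G S" if "S \<subseteq> pverts G" "card S \<le> 4" for S
      using bipartite_if_triangle_free[OF that] by blast
    \<comment> \<open>Without triangles the order is 8 and \<open>d = 2\<close>. The vertex
      \<open>w\<close> two steps from \<open>v\<close> along \<open>a\<close> has at most one
      neighbour among the other non-neighbours, so it can be added to a bipartition of the other
      four.\<close>
    have "5 \<le> card ?W" using v(2) bip[OF WV] by (cases "card ?W \<le> 4") auto
    then have "d = 2" "card ?W = 5" using card_V n d2 by auto
    then obtain a b where ab: "nbrs G v = {a, b}" "a \<noteq> b" unfolding d_def card_2_iff by blast
    have va: "(v, a) \<in> parcs G" "(v, b) \<in> parcs G" using ab(1) by (auto simp: nbrs_def)
    then have av: "(a, v) \<in> parcs G" "a \<in> pverts G" using arc_sym in_arcsD2 by blast+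
    have "card (nbrs G a - {v}) = 1"
      using deg[OF av(2)] \<open>d = 2\<close> av(1) by (simp add: nbrs_def)
    then obtain w where "nbrs G a - {v} = {w}" by (rule card_1_singletonE)
    then have aw: "(a, w) \<in> parcs G" "w \<noteq> v" by (auto simp: nbrs_def)
    have "(v, w) \<notin> parcs G" using free clique_three[of v a w] va(1) aw(1) by blast
    then have wW: "w \<in> ?W" using aw in_arcsD2 by (auto simp: non_nbrs_def)
    have wa: "a \<in> nbrs G w" using arc_sym[OF aw(1)] by (simp add: nbrs_def)
    have "card (nbrs G w - {a}) = 1"
      using deg[of w] \<open>d = 2\<close> wa wW WV by auto
    then obtain w' where w': "nbrs G w - {a} = {w'}" by (rule card_1_singletonE)
    have "a \<notin> ?W" using va by (simp add: non_nbrs_def)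
    then have one: "c = c'" if "c \<in> ?W - {w}" "c' \<in> ?W - {w}" "(w, c) \<in> parcs G" "(w, c') \<in> parcs G" for c c'
    proof -
      have "c \<in> nbrs G w - {a}" "c' \<in> nbrs G w - {a}" using that \<open>a \<notin> ?W\<close> by (auto simp: nbrs_def)
      then show ?thesis unfolding w' by simp
    qed
    have "bipartite_on G (?W - {w})" using WV wW \<open>card ?W = 5\<close> by (intro bip) auto
    then have "bipartite_on G (insert w (?W - {w}))"
      using one wW WV by (intro bipartite_insert_pendant) auto
    then show False using v(2) wW by (simp add: insert_absorb)
  qed
  define t where "t = card (triangles_at G v)"
  have t: "card (triangles_at G u) = t" if "u \<in> pverts G" for u
    unfolding t_def using vertex_transitive_invariants(3)[OF vt that v(1)] .
  have sum_t: "card (pverts G) * t = 3 * card {T. clique G T \<and> card T = 3}"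
    using sum_card_triangles_at t by simp
  have "finite {T. clique G T \<and> card T = 3}"
    by (rule finite_subset[of _ "Pow (pverts G)"]) (auto simp: clique_def pair_finite_verts)
  then have "card {T. clique G T \<and> card T = 3} > 0" using triangle by (auto simp: card_gt_0_iff)
  then have "t > 0" using sum_t by (cases t) auto
  have three: "3 dvd card (pverts G) * t" unfolding sum_t by simp
  have t_le: "t \<le> d choose 2" unfolding t_def d_def by (rule card_triangles_at_le)
  have W3: "3 \<le> card ?W"
  proof (rule ccontr)
    assume "\<not> 3 \<le> card ?W"
    then have "card T \<noteq> 3" if "T \<subseteq> ?W" for T using card_mono[OF _ that] by auto
    then show False using v(2) bipartite_if_triangle_free[OF WV] \<open>\<not> 3 \<le> card ?W\<close> by auto
  qed
  have W_ne: "?W \<noteq> {}" using W3 by auto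
  have from_nbrs: ?thesis if eq: "t = d choose 2" and "card ?W \<le> d + 1"
  proof -
    have "clique G (nbrs G u)" if "u \<in> pverts G" for u
      using nbrs_clique[of u] t[OF that] deg[OF that] eq by simp
    then have "two_cliques (insert v (nbrs G v)) ?W"
      using two_cliques_if_nbrs_cliques[OF _ deg v(1) W_ne that(2)] by blast
    then show ?thesis by blast
  qed
  have "d \<le> 4" using card_V n W3 by simp
  then consider "d = 2" | "d = 3" | "d = 4" using d2 by linarith
  then show ?thesis
  proof cases
    case 1
    then have "t = 1" using t_le \<open>t > 0\<close> by (simp add: choose_two)
    then have "3 dvd card (pverts G)" using three by simp
    \<comment> \<open>The order is 6, 7 or 8, and only 6 is divisible by 3.\<close>
    then have "card ?W = 3" using W3 card_V n 1 by presburger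
    then show ?thesis using 1 \<open>t = 1\<close> by (intro from_nbrs) (simp_all add: choose_two)
  next
    case 2
    then have "t \<le> 3" using t_le by (simp add: choose_two)
    have "card (pverts G) = 7 \<or> card (pverts G) = 8" using W3 card_V n 2 by linarith
    moreover have "t = 1 \<or> t = 2 \<or> t = 3" using \<open>t > 0\<close> \<open>t \<le> 3\<close> by linarith
    \<comment> \<open>The order, 7 or 8, is prime to 3.\<close>
    ultimately have "t = 3" using three by auto
    moreover have "card ?W \<le> 4" using card_V n 2 by simp
    ultimately show ?thesis using 2 by (intro from_nbrs) (simp_all add: choose_two)
  next
    case 3
    then have W: "card ?W = 3" and V8: "card (pverts G) = 8" using W3 card_V n by linarith+
    obtain T where T: "T \<subseteq> ?W" "clique G T" "card T = 3"
      using v(2) bipartite_if_triangle_free[OF WV] W by auto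
    then have "T = ?W" using W by (intro card_subset_eq) auto
    then have "clique G (non_nbrs G u)" if "u \<in> pverts G" for u
      using vertex_transitive_invariants(4)[OF vt v(1) that] T(2) by simp
    moreover have "card (non_nbrs G u) = 3" if "u \<in> pverts G" for u
      using vertex_transitive_invariants(1)[OF vt that v(1)] W by simp
    ultimately show ?thesis using V8 by (intro two_cliques_or_circulant_8)
  qed
qed

end

section \<open>The minimum order\<close>

lemma pair_graph_circulant_8: "pair_graph (circulant 8 {1, 2})"
  by (rule pair_graph_circulant) auto

text \<open>Besides the classification this gives the minimum, since a graph isomorphic to the
  circulant has 8 vertices. The vertex type is arbitrary: the minimum uses the equivalence on
  natural numbers, the classification on any type.\<close>

lemma LS_plus_rank_2_iff:
  assumes "pair_graph G"
  shows "vertex_transitive G \<and> card (pverts G) \<le> 8 \<and> LS_plus_rank G = 2 \<longleftrightarrow>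
    graph_iso G (circulant 8 {1, 2})"
proof -
  interpret pair_graph G by (rule assms)
  interpret C: pair_graph "circulant 8 {1, 2}" by (rule pair_graph_circulant_8)
  note iso_iff = graph_iso_iff[OF pair_wf_digraph_axioms C.pair_wf_digraph_axioms]
  show ?thesis
  proof
    assume G: "vertex_transitive G \<and> card (pverts G) \<le> 8 \<and> LS_plus_rank G = 2"
    then obtain g :: "'a \<Rightarrow> 8" where g: "inj_on g (pverts G)"
      using card_le_inj[OF pair_finite_verts, of "UNIV :: 8 set"] by auto
    have not1: "LS_plus_graph 1 G \<noteq> STAB G"
    proof
      assume "LS_plus_graph 1 G = STAB G"
      then have "LS_plus_rank G \<le> 1" unfolding LS_plus_rank_def by (rule Least_le)
      then show False using G by simp
    qed
    then obtain v where v: "v \<in> pverts G" "\<not> bipartite_on G (non_nbrs G v)"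
      using LS_plus_graph_1_eq_STAB_if_bipartite[OF g] by blast
    have "\<not> two_cliques U W" for U W
      using not1 LS_plus_graph_1_eq_STAB_if_two_cliques[OF g, of U W] unfolding two_cliques_def by blast
    then show "graph_iso G (circulant 8 {1, 2})"
      using small_vertex_transitive_cases[of v] G v unfolding iso_iff by blast
  next
    assume "graph_iso G (circulant 8 {1, 2})"
    then obtain f where f: "arc_iso f G (circulant 8 {1, 2})" unfolding iso_iff by blast
    have "vertex_transitive (circulant 8 {1, 2})" by (rule vertex_transitive_circulant) auto
    then have "vertex_transitive G"
      by (rule vertex_transitive_if_arc_iso[OF f pair_wf_digraph_axioms C.pair_wf_digraph_axioms])
    moreover have "card (pverts G) = 8"
      using f bij_betw_same_card[of f "pverts G" "{1..8}"] by (simp add: arc_iso_def circulant_def)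
    ultimately show "vertex_transitive G \<and> card (pverts G) \<le> 8 \<and> LS_plus_rank G = 2"
      using circulant_8_rank[OF f] by simp
  qed
qed

theorem proposition32:
  shows "n_plus_bar 2 = 8 \<and>
    (\<forall>G :: 'a pair_pre_digraph. pair_graph G \<longrightarrow>
       (vertex_transitive G \<and> card (pverts G) \<le> 8 \<and> LS_plus_rank G = 2
          \<longleftrightarrow> graph_iso G (circulant 8 {1, 2})))"
proof (intro conjI allI impI LS_plus_rank_2_iff)
  interpret C: pair_graph "circulant 8 {1, 2}" by (rule pair_graph_circulant_8)
  have "arc_iso id (circulant 8 {1, 2}) (circulant 8 {1, 2})" by (simp add: arc_iso_def)
  then have "graph_iso (circulant 8 {1, 2}) (circulant 8 {1, 2})"
    unfolding graph_iso_iff[OF C.pair_wf_digraph_axioms C.pair_wf_digraph_axioms] by blast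
  then have C: "vertex_transitive (circulant 8 {1, 2})" "LS_plus_rank (circulant 8 {1, 2}) = 2"
    using LS_plus_rank_2_iff[OF pair_graph_circulant_8] by auto
  show "n_plus_bar 2 = 8"
    unfolding n_plus_bar_def
  proof (rule Least_equality)
    show "\<exists>G :: nat pair_pre_digraph. pair_graph G \<and> vertex_transitive G \<and> LS_plus_rank G = 2 \<and> card (pverts G) = 8"
      using C pair_graph_circulant_8 by (intro exI[of _ "circulant 8 {1, 2}"]) (simp add: circulant_def)
    fix n
    assume "\<exists>G :: nat pair_pre_digraph. pair_graph G \<and> vertex_transitive G \<and> LS_plus_rank G = 2 \<and> card (pverts G) = n"
    then obtain G :: "nat pair_pre_digraph"
      where G: "pair_graph G" "vertex_transitive G" "LS_plus_rank G = 2" "card (pverts G) = n" by blast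
    show "8 \<le> n"
    proof (rule ccontr)
      assume "\<not> 8 \<le> n"
      then have "graph_iso G (circulant 8 {1, 2})" using LS_plus_rank_2_iff[OF G(1)] G by simp
      moreover have "pair_wf_digraph G" using G(1) by (simp add: pair_graph_def pair_digraph_def pair_fin_digraph_def)
      ultimately obtain f where "arc_iso f G (circulant 8 {1, 2})"
        using graph_iso_iff[OF _ C.pair_wf_digraph_axioms] by blast
      then have "card (pverts G) = 8"
        using bij_betw_same_card[of f "pverts G" "{1..8}"] by (simp add: arc_iso_def circulant_def)
      then show False using G(4) \<open>\<not> 8 \<le> n\<close> by simp
    qed
  qed
qed

end
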